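(* Let $\Phi$ be a Young function and let $Q$ be a unit cube in $\mathbb{R}^{2d}$. Then the Zak transform $$Zf(t,w)=\sum_{k\in\mathbb{Z}^d} f(t+k)\,e^{2\pi i k\cdot w},\qquad (t,w)\in Q,$$ is a (well-defined) continuous, linear, injective map of $W(L^{\Phi}(\mathbb{R}^d),L^1(\mathbb{R}^d))$ into $L^{\Phi}(Q)$.
   Context: A Young function is a convex function $\Phi:[0,\infty)\to[0,\infty]$ with $\Phi(0)=0$ and $\lim_{x\to\infty}\Phi(x)=\infty$; its complementary function is $\Psi(y)=\sup\{xy-\Phi(x):x>0\}$, $y\ge 0$. For $X=\mathbb{R}^d$ or $X=Q\subset\mathbb{R}^{2d}$ with Lebesgue measure, the Orlicz space $L^{\Phi}(X)$ consists of (classes of) measurable $f:X\to\mathbb{C}$ such that $\int_{X}\Phi(\alpha|f(x)|)\,dx<\infty$ for some $\alpha>0$. It carries the Orlicz norm $\|f\|_{L^\Phi}=\sup\{\int_X|f g|\,dx:\int_X\Psi(|g|)\,dx\le 1\}$, which is equivalent to the Luxemburg norm $\|f\|^{\circ}_{L^\Phi}=\inf\{k>0:\int_{X}\Phi(|f(x)|/k)\,dx\le 1\}$. Fix a compact set $Q_0\subset\mathbb{R}^d$ with nonempty interior. The Wiener amalgam space $W(L^{\Phi}(\mathbb{R}^d),L^1(\mathbb{R}^d))$ consists of all measurable $f:\mathbb{R}^d\to\mathbb{C}$ such that $f\chi_{Q_0+x}\in L^{\Phi}(\mathbb{R}^d)$ for each $x\in\mathbb{R}^d$ and $x\mapsto\|f\chi_{Q_0+x}\|_{L^{\Phi}}$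 belongs to $L^1(\mathbb{R}^d)$, with norm $\|f\|_{W(L^\Phi,L^1)}=\int_{\mathbb{R}^d}\|f\chi_{Q_0+x}\|_{L^{\Phi}}\,dx$. Different choices of $Q_0$ give the same space with equivalent norms, and with $C=[0,1]^d$ one has the equivalent discrete norm $\sum_{k\in\mathbb{Z}^d}\|f\chi_{C+k}\|_{L^\Phi}$. The series defining $Zf$ is understood as a series in $L^{\Phi}(Q)$ of the functions $(t,w)\mapsto f(t+k)e^{2\pi i k\cdot w}$, $k\in\mathbb{Z}^d$. *)

theory Defs
  imports "HOL-Analysis.Analysis"
begin

text \<open>
  Functions on \<open>[0,\<infinity>)\<close> with values in \<open>[0,\<infinity>]\<close> are represented by the type
  \<open>real \<Rightarrow> ennreal\<close>; only their values at nonnegative arguments matter.  As usual in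
  convex analysis, \<open>0 \<cdot> \<infinity> = 0\<close>, which is also the convention of \<^typ>\<open>ennreal\<close>.
\<close>

definition young_function :: "(real \<Rightarrow> ennreal) \<Rightarrow> bool" where
  "young_function \<Phi> \<longleftrightarrow>
     (\<forall>x\<ge>0. \<forall>y\<ge>0. \<forall>u\<in>{0..1}.
        \<Phi> ((1 - u) * x + u * y) \<le> ennreal (1 - u) * \<Phi> x + ennreal u * \<Phi> y) \<and>
     \<Phi> 0 = 0 \<and> (\<Phi> \<longlongrightarrow> \<infinity>) at_top"

text \<open>
  The subtraction below is truncated at 0.  This does not change the supremum if \<open>\<Phi>\<close> is a
  Young function that is finite at some positive point, since then \<open>\<Phi> x\<close> tends to 0 as \<open>x\<close>
  decreases to 0 and the supremum is nonnegative anyway.  If \<open>\<Phi>\<close> is \<open>\<infinity>\<close> on all of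
  \<open>(0,\<infinity>)\<close>, the supremum is 0 instead of \<open>-\<infinity>\<close>; the constraint on the integral of
  \<open>\<Psi>(|g|)\<close> in the Orlicz norm is void in either case.
\<close>

definition complementary :: "(real \<Rightarrow> ennreal) \<Rightarrow> real \<Rightarrow> ennreal" where
  "complementary \<Phi> y = (SUP x\<in>{0<..}. ennreal (x * y) - \<Phi> x)"

text \<open>
  Functions are not identified when they agree almost everywhere: the spaces below consist of
  the representatives, and the norms are seminorms on them.  All norms take values in
  \<open>[0,\<infinity>]\<close>.
\<close>

definition orlicz_space ::
  "(real \<Rightarrow> ennreal) \<Rightarrow> 'a measure \<Rightarrow> ('a \<Rightarrow> complex) set" where
  "orlicz_space \<Phi> M =
     {f \<in> borel_measurable M. \<exists>\<alpha>>0. (\<integral>\<^sup>+x. \<Phi> (\<alpha> * cmod (f x)) \<partial>M) < \<infinity>}"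

definition orlicz_norm ::
  "(real \<Rightarrow> ennreal) \<Rightarrow> 'a measure \<Rightarrow> ('a \<Rightarrow> complex) \<Rightarrow> ennreal" where
  "orlicz_norm \<Phi> M f =
     (SUP g \<in> {g :: 'a \<Rightarrow> complex. g \<in> borel_measurable M \<and>
                 (\<integral>\<^sup>+x. complementary \<Phi> (cmod (g x)) \<partial>M) \<le> 1}.
        \<integral>\<^sup>+x. ennreal (cmod (f x * g x)) \<partial>M)"

definition restrict_translate ::
  "('a::euclidean_space) set \<Rightarrow> ('a \<Rightarrow> complex) \<Rightarrow> 'a \<Rightarrow> 'a \<Rightarrow> complex" where
  "restrict_translate Q\<^sub>0 f x = (\<lambda>y. f y * indicator ((\<lambda>q. q + x) ` Q\<^sub>0) y)"

definition wiener_amalgam ::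
  "(real \<Rightarrow> ennreal) \<Rightarrow> ('a::euclidean_space) set \<Rightarrow> ('a \<Rightarrow> complex) set" where
  "wiener_amalgam \<Phi> Q\<^sub>0 =
     {f \<in> borel_measurable lebesgue.
        (\<forall>x. restrict_translate Q\<^sub>0 f x \<in> orlicz_space \<Phi> lebesgue) \<and>
        (\<lambda>x. orlicz_norm \<Phi> lebesgue (restrict_translate Q\<^sub>0 f x)) \<in> borel_measurable lebesgue \<and>
        (\<integral>\<^sup>+x. orlicz_norm \<Phi> lebesgue (restrict_translate Q\<^sub>0 f x) \<partial>lebesgue) < \<infinity>}"

definition wiener_amalgam_norm ::
  "(real \<Rightarrow> ennreal) \<Rightarrow> ('a::euclidean_space) set \<Rightarrow> ('a \<Rightarrow> complex) \<Rightarrow> ennreal" where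
  "wiener_amalgam_norm \<Phi> Q\<^sub>0 f =
     (\<integral>\<^sup>+x. orlicz_norm \<Phi> lebesgue (restrict_translate Q\<^sub>0 f x) \<partial>lebesgue)"

text \<open>
  Unit cubes have edges parallel to the axes and arbitrary position; any part of the boundary
  may belong to the cube, so that open, half-open and closed cubes are all covered.
\<close>

definition unit_cube :: "('a::euclidean_space) set \<Rightarrow> bool" where
  "unit_cube Q \<longleftrightarrow> (\<exists>a. box a (a + One) \<subseteq> Q \<and> Q \<subseteq> cbox a (a + One))"

definition int_lattice :: "(real ^ 'd) set" where
  "int_lattice = {k. \<forall>i. k $ i \<in> \<int>}"

definition zak_term ::
  "(real ^ 'd \<Rightarrow> complex) \<Rightarrow> real ^ 'd \<Rightarrow> (real ^ 'd) \<times> (real ^ 'd) \<Rightarrow> complex" where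
  "zak_term f k = (\<lambda>(t, w). f (t + k) * exp (2 * of_real pi * \<i> * of_real (k \<bullet> w)))"

text \<open>
  Convergence of a series in the Orlicz space.  The index set carries no order, so this is
  unordered summation: the net of all finite partial sums converges in norm.
\<close>

definition has_orlicz_sum ::
  "(real \<Rightarrow> ennreal) \<Rightarrow> 'a measure \<Rightarrow> ('i \<Rightarrow> 'a \<Rightarrow> complex) \<Rightarrow> 'i set \<Rightarrow>
     ('a \<Rightarrow> complex) \<Rightarrow> bool" where
  "has_orlicz_sum \<Phi> M u I F \<longleftrightarrow>
     (\<forall>k\<in>I. u k \<in> orlicz_space \<Phi> M) \<and> F \<in> orlicz_space \<Phi> M \<and>
     ((\<lambda>K. orlicz_norm \<Phi> M (\<lambda>z. (\<Sum>k\<in>K. u k z) - F z)) \<longlongrightarrow> 0) (finite_subsets_at_top I)"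

text \<open>
  A representative of the sum of the series; it is determined only up to null sets, and it is
  arbitrary if the series does not converge.
\<close>

definition zak_transform ::
  "(real \<Rightarrow> ennreal) \<Rightarrow> ((real ^ 'd) \<times> (real ^ 'd)) set \<Rightarrow> (real ^ 'd \<Rightarrow> complex) \<Rightarrow>
     (real ^ 'd) \<times> (real ^ 'd) \<Rightarrow> complex" where
  "zak_transform \<Phi> Q f =
     (SOME F. has_orlicz_sum \<Phi> (lebesgue_on Q) (zak_term f) int_lattice F)"

end

theory Submission
  imports Defs
begin

text \<open>
  The terms of the Zak series satisfy \<open>\<bar>f (t + k) e\<^sup>2\<^sup>\<pi>\<^sup>i\<^sup>k\<^sup>w\<bar> = \<bar>f (t + k)\<bar>\<close>, so by Fubini the modular of
  \<open>zak_term f k\<close> over \<open>Q\<close> is the modular of \<open>f\<close> over a unit cube translated by \<open>k\<close>.  Comparing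
  the Orlicz norm with the modular (Luxemburg norm) in both directions bounds the norm of the
  \<open>k\<close>-th term by twice the norm of \<open>f\<close> on that cube, and the sum over \<open>k\<close> of these is the
  discrete amalgam norm, which the continuous one dominates.  The series thus converges
  absolutely.  On sets of finite measure the Orlicz norm dominates the \<open>L\<^sup>1\<close> norm; hence, when
  the sum vanishes, the integrals over \<open>w\<close> of the partial sums against \<open>e\<^sup>-\<^sup>2\<^sup>\<pi>\<^sup>i\<^sup>j\<^sup>w\<close>, which are
  \<open>f (t + j)\<close>, tend to 0 in \<open>L\<^sup>1\<close>, so \<open>f = 0\<close>.
\<close>

section \<open>Young functions\<close>

text \<open>The modular is used because the test functions over \<open>Q\<close> depend on
  \<open>(t, w)\<close> and those over the base space on one variable only, so the two norms are not
  directly comparable test by test, whereas the modular of a term sees only |f|. The hard half is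
  from norm to modular. \<open>\<Phi>\<close> need be neither finite nor left-continuous: if it is 0
  on [0,1) and infinite from 1 on, the constant 1 on a set of measure 1 has Orlicz norm 1 and
  infinite modular. Hence every passage from norm to modular gives up a factor below 1 or starts
  from a strict bound, and the limit is taken afterwards. The other half follows from Young's
  inequality and costs an additional 1 for the test function; this 1 + 1 is the factor 2.
  \<open>zak_transform\<close> picks an arbitrary sum, so its linearity and its norm bound have to
  pass through uniqueness almost everywhere.\<close>

lemma young_zero: "young_function \<Phi> \<Longrightarrow> \<Phi> 0 = 0"
  by (simp add: young_function_def)

lemma young_convex:
  assumes "young_function \<Phi>" "0 \<le> x" "0 \<le> y" "0 \<le> u" "u \<le> 1"
  shows "\<Phi> ((1 - u) * x + u * y) \<le> ennreal (1 - u) * \<Phi> x + ennreal u * \<Phi> y"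
  using assms by (auto simp: young_function_def)

lemma young_mono:
  assumes "young_function \<Phi>" "0 \<le> x" "x \<le> y"
  shows "\<Phi> x \<le> \<Phi> y"
proof (cases "y = 0")
  case False
  define u where "u = x / y"
  have u: "u \<in> {0..1}" "x = u * y" using assms False by (auto simp: u_def)
  have "\<Phi> ((1 - u) * 0 + u * y) \<le> ennreal (1 - u) * \<Phi> 0 + ennreal u * \<Phi> y"
    by (rule young_convex) (use assms u in auto)
  also have "\<dots> = ennreal u * \<Phi> y" by (simp add: young_zero[OF assms(1)])
  also have "\<dots> \<le> 1 * \<Phi> y" using u(1) by (intro mult_right_mono) auto
  finally show ?thesis using u(2) by simp
qed (use assms in auto)

lemma young_scale:
  assumes "young_function \<Phi>" "0 \<le> x" "0 \<le> u" "u \<le> 1"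
  shows "\<Phi> (u * x) \<le> ennreal u * \<Phi> x"
proof -
  have "\<Phi> ((1 - u) * 0 + u * x) \<le> ennreal (1 - u) * \<Phi> 0 + ennreal u * \<Phi> x"
    by (rule young_convex) (use assms in auto)
  then show ?thesis using assms(1) by (simp add: young_function_def)
qed

lemma mono_ennreal_measurable:
  fixes \<phi> :: "real \<Rightarrow> ennreal"
  assumes "mono \<phi>"
  shows "\<phi> \<in> borel_measurable borel"
proof (rule borel_measurableI_greater)
  fix c
  have "is_interval {x. c < \<phi> x}"
    using monoD[OF assms] unfolding is_interval_1 by (auto intro: less_le_trans)
  then show "{x \<in> space borel. c < \<phi> x} \<in> sets borel"
    by (simp add: real_interval_borel_measurable)
qed

text \<open>A Young function may take any values at negative arguments, so it is first clamped with
  \<open>max 0\<close>, which makes it monotone on the whole line.\<close>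

lemma mono_on_nonneg_measurable:
  fixes \<phi> :: "real \<Rightarrow> ennreal"
  assumes "\<And>x y. 0 \<le> x \<Longrightarrow> x \<le> y \<Longrightarrow> \<phi> x \<le> \<phi> y"
    and "f \<in> borel_measurable M" "\<And>x. x \<in> space M \<Longrightarrow> 0 \<le> f x"
  shows "(\<lambda>x. \<phi> (f x)) \<in> borel_measurable M"
proof -
  have "mono (\<lambda>x. \<phi> (max 0 x))" by (intro monoI assms(1)) auto
  then have "(\<lambda>x. \<phi> (max 0 x)) \<in> borel_measurable borel"
    by (rule mono_ennreal_measurable)
  from measurable_compose[OF assms(2) this]
  have "(\<lambda>x. \<phi> (max 0 (f x))) \<in> borel_measurable M" .
  then show ?thesis
    by (rule measurable_cong[THEN iffD1, rotated]) (use assms(3) in \<open>simp add: max_def\<close>)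
qed

lemma young_measurable:
  assumes "young_function \<Phi>" "f \<in> borel_measurable M" "\<And>x. x \<in> space M \<Longrightarrow> 0 \<le> f x"
  shows "(\<lambda>x. \<Phi> (f x)) \<in> borel_measurable M"
  by (rule mono_on_nonneg_measurable[OF young_mono[OF assms(1)] assms(2,3)])

section \<open>The complementary function and Young's inequality\<close>

lemma complementary_mono:
  assumes "x \<le> y"
  shows "complementary \<Phi> x \<le> complementary \<Phi> y"
  unfolding complementary_def
  by (intro SUP_subset_mono order_refl)
    (use assms in \<open>auto intro!: ennreal_minus_mono ennreal_leI\<close>)

lemma complementary_measurable [measurable (raw)]:
  assumes "f \<in> borel_measurable M"
  shows "(\<lambda>x. complementary \<Phi> (f x)) \<in> borel_measurable M"
proof -
  have "complementary \<Phi> \<in> borel_measurable borel"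
    by (intro mono_ennreal_measurable monoI complementary_mono)
  from measurable_compose[OF assms this] show ?thesis .
qed

lemma complementary_zero [simp]: "complementary \<Phi> 0 = 0"
  unfolding complementary_def by (intro antisym SUP_least) auto

text \<open>Moving \<open>\<Phi> x\<close> to the right-hand side avoids truncated subtraction and
  covers infinite values without a case distinction.\<close>

lemma complementary_leI:
  assumes "\<And>x. 0 < x \<Longrightarrow> ennreal (x * y) \<le> \<Phi> x + c"
  shows "complementary \<Phi> y \<le> c"
  unfolding complementary_def
  by (intro SUP_least) (use assms in \<open>auto simp: ennreal_minus_le_iff\<close>)

lemma young_inequality:
  assumes "0 \<le> x"
  shows "ennreal (x * y) \<le> \<Phi> x + complementary \<Phi> y"
proof (cases "x = 0")
  case False
  then have "ennreal (x * y) - \<Phi> x \<le> complementary \<Phi> y"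
    unfolding complementary_def using assms by (intro SUP_upper) auto
  then show ?thesis by (simp add: ennreal_minus_le_iff)
qed simp

text \<open>Multiply Young's inequality by \<open>u\<close> and use
  \<open>u * \<Phi> x \<le> \<Phi> x\<close>. This is how a function with finite complementary
  modular is shrunk to an admissible test function.\<close>

lemma complementary_scale:
  assumes "young_function \<Phi>" "0 \<le> u" "u \<le> 1"
  shows "complementary \<Phi> (u * y) \<le> ennreal u * complementary \<Phi> y"
proof (rule complementary_leI)
  fix x :: real assume x: "0 < x"
  have "ennreal (x * (u * y)) = ennreal u * ennreal (x * y)"
    using assms(2) by (metis ennreal_mult' mult.left_commute)
  also have "\<dots> \<le> ennreal u * (\<Phi> x + complementary \<Phi> y)"
    by (intro mult_left_mono young_inequality) (use x in auto)
  also have "\<dots> \<le> 1 * \<Phi> x + ennreal u * complementary \<Phi> y"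
    unfolding distrib_left by (intro add_mono mult_right_mono) (use assms in auto)
  finally show "ennreal (x * (u * y)) \<le> \<Phi> x + ennreal u * complementary \<Phi> y" by simp
qed

text \<open>A supporting line of slope \<open>s\<close> at \<open>x\<close>, in additive form
  because \<open>\<Phi> z\<close> may be infinite. The point \<open>y\<close> places
  \<open>x\<close> strictly inside the interval where \<open>\<Phi>\<close> is finite; this keeps
  the slope finite.\<close>

lemma young_subgradient:
  assumes Y: "young_function \<Phi>" and x: "0 < x" "x < y" and fin: "\<Phi> y < \<infinity>"
  shows "\<exists>s\<ge>0. \<forall>z\<ge>0. ennreal (s * z) + \<Phi> x \<le> \<Phi> z + ennreal (s * x)"
proof -
  define p where "p = (\<lambda>t. enn2real (\<Phi> t))"
  have \<Phi>p: "\<Phi> t = ennreal (p t)" if "0 \<le> t" "t \<le> y" for t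
    using young_mono[OF Y that] fin by (simp add: p_def less_top)
  have p0: "p t \<ge> 0" for t by (simp add: p_def)
  have conv: "convex_on {0..y} p"
  proof (rule convex_onI)
    fix t a b :: real assume *: "0 < t" "t < 1" "a \<in> {0..y}" "b \<in> {0..y}"
    have mem: "(1 - t) * a + t * b \<in> {0..y}"
      using convexD[OF convex_real_interval(5)[of 0 y] *(3,4), of "1 - t" t] * by simp
    have "\<Phi> ((1 - t) * a + t * b) \<le> ennreal (1 - t) * \<Phi> a + ennreal t * \<Phi> b"
      using Y * unfolding young_function_def by auto
    also have "\<dots> = ennreal ((1 - t) * p a + t * p b)"
      using * by (simp add: \<Phi>p p0 ennreal_mult ennreal_plus)
    finally have "ennreal (p ((1 - t) * a + t * b)) \<le> ennreal ((1 - t) * p a + t * p b)"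
      using mem by (simp add: \<Phi>p)
    then show "p ((1 - t) *\<^sub>R a + t *\<^sub>R b) \<le> (1 - t) * p a + t * p b"
      using * p0 by (subst (asm) ennreal_le_iff) auto
  qed simp
  \<comment> \<open>The right derivative at \<open>x\<close>: the infimum of the difference
    quotients towards points to the right.\<close>
  define s where "s = Inf ((\<lambda>t. (p x - p t) / (x - t)) ` ({x<..} \<inter> {0..y}))"
  have sub: "p t \<ge> p x + s * (t - x)" if "t \<in> {0..y}" for t
    using convex_le_Inf_differential[OF conv, of x t] x that by (simp add: s_def)
  have "p 0 = 0" using young_zero[OF Y] by (simp add: p_def)
  \<comment> \<open>At 0 the supporting line lies below \<open>p 0 = 0\<close>; as it passes through
    the nonnegative value \<open>p x\<close> at \<open>x > 0\<close>, it cannot decrease.\<close>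
  with sub[of 0] x p0[of x] have sx: "s * x \<ge> p x" by (simp add: algebra_simps)
  with x p0[of x] have "s \<ge> 0" by (smt (verit) mult_neg_pos)
  have ge: "ennreal (s * z) + \<Phi> x \<le> \<Phi> z + ennreal (s * x)" if z: "0 \<le> z" for z
  proof (cases "\<Phi> z = \<infinity>")
    case False
    show ?thesis
    proof (cases "z \<le> y")
      case True
      have "s * z + p x \<le> p z + s * x" using sub[of z] True z by (simp add: algebra_simps)
      then show ?thesis using True z x \<open>s \<ge> 0\<close> p0
        by (simp add: \<Phi>p flip: ennreal_plus)
    next
      case zy: False
      \<comment> \<open>\<open>p\<close> is known to be convex only on \<open>[0, y]\<close>; the chord from \<open>x\<close> to \<open>z\<close> carries the inequality from \<open>y\<close> to \<open>z\<close>\<close>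
      define q where "q = enn2real (\<Phi> z)"
      have q: "\<Phi> z = ennreal q" "q \<ge> 0" using False by (auto simp: q_def less_top)
      define u where "u = (y - x) / (z - x)"
      have u: "0 < u" "u < 1" "y = (1 - u) * x + u * z"
        using x zy by (auto simp: u_def divide_simps) (simp add: algebra_simps)
      have "\<Phi> y \<le> ennreal (1 - u) * \<Phi> x + ennreal u * \<Phi> z"
        using Y u x z unfolding young_function_def by auto
      then have "p y \<le> (1 - u) * p x + u * q"
        using u x q p0 by (simp add: \<Phi>p flip: ennreal_mult ennreal_plus)
      moreover have "p y \<ge> p x + s * (y - x)" using sub[of y] x by simp
      moreover have "y - x = u * (z - x)" using u by (simp add: algebra_simps)
      ultimately have "u * (s * (z - x)) \<le> u * (q - p x)" by (simp add: algebra_simps)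
      then have "s * (z - x) \<le> q - p x" using u by simp
      then have "s * z + p x \<le> q + s * x" by (simp add: algebra_simps)
      then show ?thesis using z x \<open>s \<ge> 0\<close> p0 q
        by (simp add: \<Phi>p flip: ennreal_plus)
    qed
  qed auto
  with \<open>s \<ge> 0\<close> show ?thesis by blast
qed

section \<open>Orlicz norm and modular\<close>

definition orlicz_test :: "(real \<Rightarrow> ennreal) \<Rightarrow> 'a measure \<Rightarrow> ('a \<Rightarrow> complex) set" where
  "orlicz_test \<Phi> M = {g \<in> borel_measurable M. (\<integral>\<^sup>+x. complementary \<Phi> (cmod (g x)) \<partial>M) \<le> 1}"

text \<open>The Orlicz norm of \<open>[0,\<infinity>]\<close>-valued functions, needed for pointwise infinite sums.\<close>

definition orlicz_norm_nn :: "(real \<Rightarrow> ennreal) \<Rightarrow> 'a measure \<Rightarrow> ('a \<Rightarrow> ennreal) \<Rightarrow> ennreal" where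
  "orlicz_norm_nn \<Phi> M h = (SUP g \<in> orlicz_test \<Phi> M. \<integral>\<^sup>+x. h x * ennreal (cmod (g x)) \<partial>M)"

lemma orlicz_testD [measurable_dest]: "g \<in> orlicz_test \<Phi> M \<Longrightarrow> g \<in> borel_measurable M"
  by (simp add: orlicz_test_def)

lemma orlicz_norm_eq_nn: "orlicz_norm \<Phi> M f = orlicz_norm_nn \<Phi> M (\<lambda>x. ennreal (cmod (f x)))"
  by (simp add: orlicz_norm_def orlicz_norm_nn_def orlicz_test_def norm_mult ennreal_mult conj_commute)

lemma orlicz_norm_nn_upper:
  fixes g :: "'a \<Rightarrow> real"
  assumes "g \<in> borel_measurable M" "\<And>x. 0 \<le> g x" "(\<integral>\<^sup>+x. complementary \<Phi> (g x) \<partial>M) \<le> 1"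
  shows "(\<integral>\<^sup>+x. h x * ennreal (g x) \<partial>M) \<le> orlicz_norm_nn \<Phi> M h"
proof -
  have "(\<lambda>x. complex_of_real (g x)) \<in> orlicz_test \<Phi> M"
    using assms by (simp add: orlicz_test_def)
  from SUP_upper[OF this, of "\<lambda>g. \<integral>\<^sup>+x. h x * ennreal (cmod (g x)) \<partial>M"] show ?thesis
    using assms(2) by (simp add: orlicz_norm_nn_def)
qed

lemma orlicz_norm_nn_mono_AE:
  assumes "AE x in M. h x \<le> h' x"
  shows "orlicz_norm_nn \<Phi> M h \<le> orlicz_norm_nn \<Phi> M h'"
  unfolding orlicz_norm_nn_def
proof (intro SUP_subset_mono order_refl nn_integral_mono_AE)
  fix g show "AE x in M. h x * ennreal (cmod (g x)) \<le> h' x * ennreal (cmod (g x))"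
    using assms by eventually_elim (rule mult_right_mono, auto)
qed

lemma orlicz_norm_nn_cmult:
  assumes [measurable]: "h \<in> borel_measurable M"
  shows "orlicz_norm_nn \<Phi> M (\<lambda>x. c * h x) = c * orlicz_norm_nn \<Phi> M h"
proof -
  have "orlicz_norm_nn \<Phi> M (\<lambda>x. c * h x)
      = (SUP g \<in> orlicz_test \<Phi> M. c * (\<integral>\<^sup>+x. h x * ennreal (cmod (g x)) \<partial>M))"
    unfolding orlicz_norm_nn_def
    by (intro SUP_cong refl) (simp add: nn_integral_cmult mult.assoc orlicz_testD)
  then show ?thesis by (simp add: orlicz_norm_nn_def SUP_mult_left_ennreal)
qed

lemma orlicz_norm_nn_add:
  assumes [measurable]: "h \<in> borel_measurable M" "h' \<in> borel_measurable M"
  shows "orlicz_norm_nn \<Phi> M (\<lambda>x. h x + h' x) \<le> orlicz_norm_nn \<Phi> M h + orlicz_norm_nn \<Phi> M h'"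
  unfolding orlicz_norm_nn_def
proof (rule SUP_least)
  fix g assume g [measurable]: "g \<in> orlicz_test \<Phi> M"
  have "(\<integral>\<^sup>+x. (h x + h' x) * ennreal (cmod (g x)) \<partial>M)
      = (\<integral>\<^sup>+x. h x * ennreal (cmod (g x)) \<partial>M) + (\<integral>\<^sup>+x. h' x * ennreal (cmod (g x)) \<partial>M)"
    by (simp add: distrib_right nn_integral_add)
  also have "\<dots> \<le> (SUP g \<in> orlicz_test \<Phi> M. \<integral>\<^sup>+x. h x * ennreal (cmod (g x)) \<partial>M) +
                   (SUP g \<in> orlicz_test \<Phi> M. \<integral>\<^sup>+x. h' x * ennreal (cmod (g x)) \<partial>M)"
    by (intro add_mono SUP_upper g)
  finally show "(\<integral>\<^sup>+x. (h x + h' x) * ennreal (cmod (g x)) \<partial>M) \<le> \<dots>" .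
qed

text \<open>The triangle inequality for infinitely many terms. For one fixed test function Tonelli
  exchanges sum and integral; the supremum is then taken in each term separately.\<close>

lemma orlicz_norm_nn_countable_sum:
  assumes "countable I" and [measurable]: "\<And>i. i \<in> I \<Longrightarrow> h i \<in> borel_measurable M"
  shows "orlicz_norm_nn \<Phi> M (\<lambda>x. \<integral>\<^sup>+i. h i x \<partial>count_space I)
      \<le> (\<integral>\<^sup>+i. orlicz_norm_nn \<Phi> M (h i) \<partial>count_space I)"
  unfolding orlicz_norm_nn_def
proof (rule SUP_least)
  fix g assume g [measurable]: "g \<in> orlicz_test \<Phi> M"
  have "(\<integral>\<^sup>+x. (\<integral>\<^sup>+i. h i x \<partial>count_space I) * ennreal (cmod (g x)) \<partial>M)
      = (\<integral>\<^sup>+x. (\<integral>\<^sup>+i. h i x * ennreal (cmod (g x)) \<partial>count_space I) \<partial>M)"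
    by (intro nn_integral_cong) (simp add: nn_integral_multc)
  also have "\<dots> = (\<integral>\<^sup>+i. (\<integral>\<^sup>+x. h i x * ennreal (cmod (g x)) \<partial>M) \<partial>count_space I)"
    by (intro nn_integral_count_space_nn_integral assms(1)) measurable
  also have "\<dots> \<le> (\<integral>\<^sup>+i. (SUP g \<in> orlicz_test \<Phi> M. \<integral>\<^sup>+x. h i x * ennreal (cmod (g x)) \<partial>M) \<partial>count_space I)"
    by (intro nn_integral_mono SUP_upper g)
  finally show "(\<integral>\<^sup>+x. (\<integral>\<^sup>+i. h i x \<partial>count_space I) * ennreal (cmod (g x)) \<partial>M) \<le> \<dots>" .
qed

lemma orlicz_norm_cmult:
  assumes [measurable]: "f \<in> borel_measurable M"
  shows "orlicz_norm \<Phi> M (\<lambda>x. a * f x) = ennreal (cmod a) * orlicz_norm \<Phi> M f"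
  unfolding orlicz_norm_eq_nn by (simp add: norm_mult ennreal_mult orlicz_norm_nn_cmult)

lemma orlicz_norm_triangle:
  assumes [measurable]: "f \<in> borel_measurable M" "g \<in> borel_measurable M"
  shows "orlicz_norm \<Phi> M (\<lambda>x. f x + g x) \<le> orlicz_norm \<Phi> M f + orlicz_norm \<Phi> M g"
proof -
  have "orlicz_norm \<Phi> M (\<lambda>x. f x + g x)
     \<le> orlicz_norm_nn \<Phi> M (\<lambda>x. ennreal (cmod (f x)) + ennreal (cmod (g x)))"
    unfolding orlicz_norm_eq_nn
    by (intro orlicz_norm_nn_mono_AE AE_I2) (simp add: norm_triangle_ineq flip: ennreal_plus)
  also have "\<dots> \<le> orlicz_norm \<Phi> M f + orlicz_norm \<Phi> M g"
    unfolding orlicz_norm_eq_nn by (intro orlicz_norm_nn_add) measurable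
  finally show ?thesis .
qed

lemma orlicz_norm_mono_AE:
  assumes "AE x in M. cmod (f x) \<le> cmod (g x)"
  shows "orlicz_norm \<Phi> M f \<le> orlicz_norm \<Phi> M g"
  unfolding orlicz_norm_eq_nn
  by (intro orlicz_norm_nn_mono_AE) (use assms in \<open>simp add: ennreal_leI\<close>)

lemma orlicz_norm_cong_AE:
  assumes "AE x in M. f x = g x"
  shows "orlicz_norm \<Phi> M f = orlicz_norm \<Phi> M g"
  by (intro antisym orlicz_norm_mono_AE) (use assms in auto)

text \<open>Young's inequality under the integral; the 1 is the bound on the complementary modular
  of a test function.\<close>

lemma orlicz_norm_le_modular:
  assumes Y: "young_function \<Phi>" and [measurable]: "f \<in> borel_measurable M"
  shows "orlicz_norm \<Phi> M f \<le> (\<integral>\<^sup>+x. \<Phi> (cmod (f x)) \<partial>M) + 1"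
  unfolding orlicz_norm_eq_nn orlicz_norm_nn_def
proof (rule SUP_least)
  fix g assume g [measurable]: "g \<in> orlicz_test \<Phi> M"
  note [measurable] = young_measurable[OF Y]
  have "(\<integral>\<^sup>+x. ennreal (cmod (f x)) * ennreal (cmod (g x)) \<partial>M)
      \<le> (\<integral>\<^sup>+x. \<Phi> (cmod (f x)) + complementary \<Phi> (cmod (g x)) \<partial>M)"
    by (intro nn_integral_mono) (simp add: young_inequality flip: ennreal_mult)
  also have "\<dots> = (\<integral>\<^sup>+x. \<Phi> (cmod (f x)) \<partial>M) + (\<integral>\<^sup>+x. complementary \<Phi> (cmod (g x)) \<partial>M)"
    by (rule nn_integral_add) measurable
  also have "\<dots> \<le> (\<integral>\<^sup>+x. \<Phi> (cmod (f x)) \<partial>M) + 1"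
    using g by (intro add_left_mono) (simp add: orlicz_test_def)
  finally show "(\<integral>\<^sup>+x. ennreal (cmod (f x)) * ennreal (cmod (g x)) \<partial>M) \<le> \<dots>" .
qed

text \<open>Subgradients exist only where \<open>\<Phi>\<close> is finite to the right, so infinite
  values are excluded first. On a piece of measure \<open>m\<close> where
  \<open>\<Phi> (\<alpha> * |f|)\<close> is infinite, \<open>1 / (\<alpha> * m * |f|)\<close> is an
  admissible test function, and its integral against |f| is \<open>1 / \<alpha> > 1\<close>.\<close>

lemma (in sigma_finite_measure) AE_young_finite:
  assumes Y: "young_function \<Phi>" and [measurable]: "f \<in> borel_measurable M"
    and N: "orlicz_norm \<Phi> M f \<le> 1" and \<alpha>: "0 < \<alpha>" "\<alpha> < 1"
  shows "AE x in M. \<Phi> (\<alpha> * cmod (f x)) < \<infinity>"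
proof -
  note [measurable] = young_measurable[OF Y]
  define A where "A = {x \<in> space M. \<Phi> (\<alpha> * cmod (f x)) = \<infinity>}"
  have "(\<lambda>x. \<Phi> (\<alpha> * cmod (f x))) \<in> borel_measurable M"
    by (rule young_measurable[OF Y]) (use \<alpha> in auto)
  then have A [measurable]: "A \<in> sets M" unfolding A_def by measurable
  obtain B :: "nat \<Rightarrow> 'a set" where B: "range B \<subseteq> sets M" "(\<Union>i. B i) = space M"
    "\<And>i. emeasure M (B i) \<noteq> \<infinity>" by (rule sigma_finite) blast
  have "emeasure M (A \<inter> B n) = 0" for n
  proof (rule ccontr)
    assume ne: "emeasure M (A \<inter> B n) \<noteq> 0"
    have Bn [measurable]: "B n \<in> sets M" using B(1) by auto
    have fin: "emeasure M (A \<inter> B n) \<noteq> \<infinity>"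
      using B(3)[of n] emeasure_mono[of "A \<inter> B n" "B n" M] by (auto simp: top_unique)
    define m where "m = measure M (A \<inter> B n)"
    have m: "emeasure M (A \<inter> B n) = ennreal m" "m > 0"
      using ne fin by (auto simp: m_def emeasure_eq_ennreal_measure zero_less_measure_iff)
    \<comment> \<open>on \<open>A\<close> only \<open>t < \<alpha> \<bar>f x\<bar>\<close> contribute to \<open>\<Psi> (g x)\<close>, whence \<open>\<Psi> (g x) \<le> 1 / m\<close>\<close>
    define g where "g = (\<lambda>x. if x \<in> A \<inter> B n then 1 / (\<alpha> * m * cmod (f x)) else 0)"
    have [measurable]: "g \<in> borel_measurable M" unfolding g_def by measurable
    have pos: "cmod (f x) > 0" if "x \<in> A" for x
      using that young_zero[OF Y] by (cases "f x = 0") (auto simp: A_def)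
    have "complementary \<Phi> (g x) \<le> ennreal (1 / m) * indicator (A \<inter> B n) x" for x
    proof (cases "x \<in> A \<inter> B n")
      case True
      have "complementary \<Phi> (g x) \<le> ennreal (1 / m)"
      proof (rule complementary_leI)
        fix t :: real assume t: "0 < t"
        show "ennreal (t * g x) \<le> \<Phi> t + ennreal (1 / m)"
        proof (cases "\<alpha> * cmod (f x) \<le> t")
          case le: True
          have "\<Phi> (\<alpha> * cmod (f x)) \<le> \<Phi> t" by (rule young_mono[OF Y]) (use le \<alpha> in auto)
          then show ?thesis using True by (auto simp: A_def top_unique)
        next
          case False
          have "t * g x \<le> \<alpha> * cmod (f x) * g x"
            using False \<alpha> m(2) True by (intro mult_right_mono) (auto simp: g_def)
          also have "\<dots> = 1 / m" using True pos \<alpha> m(2) by (auto simp: g_def)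
          finally show ?thesis by (simp add: ennreal_leI add_increasing)
        qed
      qed
      then show ?thesis using True by simp
    qed (auto simp: g_def)
    then have "(\<integral>\<^sup>+x. complementary \<Phi> (g x) \<partial>M) \<le> (\<integral>\<^sup>+x. ennreal (1 / m) * indicator (A \<inter> B n) x \<partial>M)"
      by (intro nn_integral_mono)
    also have "\<dots> = 1" using m by (simp add: nn_integral_cmult_indicator flip: ennreal_mult)
    finally have "(\<integral>\<^sup>+x. complementary \<Phi> (g x) \<partial>M) \<le> 1" .
    moreover have "0 \<le> g x" for x using \<alpha> m by (simp add: g_def)
    ultimately have "(\<integral>\<^sup>+x. ennreal (cmod (f x)) * ennreal (g x) \<partial>M) \<le> 1"
      using N unfolding orlicz_norm_eq_nn by (intro order_trans[OF orlicz_norm_nn_upper]) auto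
    also have "(\<integral>\<^sup>+x. ennreal (cmod (f x)) * ennreal (g x) \<partial>M)
        = (\<integral>\<^sup>+x. ennreal (1 / (\<alpha> * m)) * indicator (A \<inter> B n) x \<partial>M)"
      using pos \<alpha> m by (intro nn_integral_cong) (auto simp: g_def indicator_def simp flip: ennreal_mult)
    also have "\<dots> = ennreal (1 / \<alpha>)"
      using m \<alpha> by (simp add: nn_integral_cmult_indicator flip: ennreal_mult)
    finally show False using \<alpha> by simp
  qed
  then have "emeasure M (\<Union>n. A \<inter> B n) = 0"
    using B(1) by (intro emeasure_UN_eq_0) auto
  moreover have "(\<Union>n. A \<inter> B n) = A" using B(2) A_def by auto
  ultimately have "AE x in M. x \<notin> A" by (intro AE_not_in) (auto simp: null_sets_def)
  with AE_space show ?thesis by eventually_elim (auto simp: A_def less_top)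
qed

text \<open>Off the domain below, \<open>\<Phi>\<close> need not have a finite subgradient.\<close>

definition young_dom :: "(real \<Rightarrow> ennreal) \<Rightarrow> real set" where
  "young_dom \<Phi> = {x. 0 < x \<and> (\<exists>y>x. \<Phi> y < \<infinity>)}"

lemma young_dom_borel: "young_dom \<Phi> \<in> sets borel"
proof -
  have "is_interval (young_dom \<Phi>)"
    unfolding is_interval_1 young_dom_def by auto (meson le_less_trans order.strict_trans1)+
  then show ?thesis by (rule real_interval_borel_measurable)
qed

text \<open>A choice of subgradients that attains equality in Young's inequality. Measurability
  needs no careful selection: subgradients of a convex function increase, so any choice is monotone
  on the domain.\<close>

lemma young_subgradient_function:
  assumes Y: "young_function \<Phi>"
  obtains s :: "real \<Rightarrow> real" where "s \<in> borel_measurable borel" "\<And>x. 0 \<le> s x"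
    "\<And>x. x \<in> young_dom \<Phi> \<Longrightarrow> complementary \<Phi> (s x) + \<Phi> x \<le> ennreal (s x * x)"
proof -
  define D where "D = young_dom \<Phi>"
  note D_def = D_def[unfolded young_dom_def]
  have "\<forall>x\<in>D. \<exists>s\<ge>0. \<forall>z\<ge>0. ennreal (s * z) + \<Phi> x \<le> \<Phi> z + ennreal (s * x)"
    using young_subgradient[OF Y] unfolding D_def by blast
  then obtain r where r: "\<And>x. x \<in> D \<Longrightarrow> r x \<ge> 0"
    "\<And>x z. x \<in> D \<Longrightarrow> z \<ge> 0 \<Longrightarrow> ennreal (r x * z) + \<Phi> x \<le> \<Phi> z + ennreal (r x * x)"
    by metis
  have fin: "\<exists>p\<ge>0. \<Phi> x = ennreal p" if "x \<in> D" for x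
  proof -
    from that obtain y where "0 < x" "x < y" "\<Phi> y < \<infinity>" by (auto simp: D_def)
    with young_mono[OF Y, of x y] have "\<Phi> x \<noteq> top" by (auto simp: top_unique)
    then show ?thesis by (cases "\<Phi> x" rule: ennreal_cases) auto
  qed
  have D: "D \<in> sets borel" unfolding D_def by (rule young_dom_borel[unfolded young_dom_def])
  have "mono_on D r"
  proof (rule mono_onI)
    fix x y assume xy: "x \<in> D" "y \<in> D" "x \<le> y"
    show "r x \<le> r y"
    proof (cases "x = y")
      case False
      obtain p q where pq: "p \<ge> 0" "\<Phi> x = ennreal p" "q \<ge> 0" "\<Phi> y = ennreal q"
        using fin xy by metis
      have pos: "0 < x" "0 < y" using xy by (auto simp: D_def)
      \<comment> \<open>The supporting line at each of the two points is evaluated at the other;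
        adding both inequalities eliminates \<open>p\<close> and \<open>q\<close>.\<close>
      have "r x * y + p \<le> q + r x * x" "r y * x + q \<le> p + r y * y"
        using r(2)[OF xy(1), of y] r(2)[OF xy(2), of x] r(1) xy pq pos
        by (simp_all flip: ennreal_plus)
      then have "0 \<le> (r y - r x) * (y - x)" by (simp add: algebra_simps)
      then show ?thesis using False xy(3) by (simp add: zero_le_mult_iff)
    qed simp
  qed
  then have "r \<in> borel_measurable (restrict_space borel D)"
    using D by (intro borel_measurable_mono_on_fnc)
  then have m: "(\<lambda>x. if x \<in> D then r x else 0) \<in> borel_measurable borel"
    using D by (subst measurable_restrict_space_iff[symmetric]) auto
  have "complementary \<Phi> (r x) + \<Phi> x \<le> ennreal (r x * x)" if x: "x \<in> D" for x
  proof -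
    obtain p where p: "p \<ge> 0" "\<Phi> x = ennreal p" using fin[OF x] by blast
    have rx: "r x \<ge> 0" "x > 0" using r(1)[OF x] x by (auto simp: D_def)
    \<comment> \<open>The supporting line at 0, so that the difference \<open>r x * x - p\<close>
      below is nonnegative.\<close>
    have le: "p \<le> r x * x" using r(2)[OF x, of 0] p rx young_zero[OF Y] by simp
    have "complementary \<Phi> (r x) \<le> ennreal (r x * x - p)"
    proof (rule complementary_leI)
      fix z :: real assume z: "0 < z"
      show "ennreal (z * r x) \<le> \<Phi> z + ennreal (r x * x - p)"
      proof (cases "\<Phi> z" rule: ennreal_cases)
        case (real q)
        then show ?thesis using r(2)[OF x, of z] p z le rx
          by (simp add: mult.commute flip: ennreal_plus)
      qed simp
    qed
    then have "complementary \<Phi> (r x) + \<Phi> x \<le> ennreal (r x * x - p) + ennreal p"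
      using p by (intro add_mono) auto
    then show ?thesis using le p by (simp flip: ennreal_plus)
  qed
  with that[OF m] r(1) show ?thesis by (auto simp: D_def young_dom_def)
qed


text \<open>
  Equality holds in Young's inequality for \<open>u = \<alpha> \<bar>f\<bar>\<close> and \<open>g = s \<circ> u\<close>, where \<open>s\<close> is a subgradient of \<open>\<Phi>\<close>.
  Truncating to sets \<open>E n\<close> on which \<open>\<rho> = \<integral> \<Psi> (g)\<close> is finite and testing the norm with \<open>g / max 1 \<rho>\<close>
  gives \<open>\<rho> + \<integral> \<Phi> (u) \<le> max 1 \<rho>\<close>.
\<close>

lemma (in sigma_finite_measure) modular_le_one:
  assumes Y: "young_function \<Phi>" and [measurable]: "f \<in> borel_measurable M"
    and N: "orlicz_norm \<Phi> M f \<le> 1" and \<alpha>: "0 < \<alpha>" "\<alpha> < 1"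
  shows "(\<integral>\<^sup>+x. \<Phi> (\<alpha> * cmod (f x)) \<partial>M) \<le> 1"
proof -
  obtain s where s: "s \<in> borel_measurable borel" "\<And>x. 0 \<le> s x"
    "\<And>x. x \<in> young_dom \<Phi> \<Longrightarrow> complementary \<Phi> (s x) + \<Phi> x \<le> ennreal (s x * x)"
    by (rule young_subgradient_function[OF Y]) (rule that)
  note [measurable] = s(1) young_dom_borel
  have \<Phi>m [measurable]: "(\<lambda>x. \<Phi> (\<alpha> * cmod (f x))) \<in> borel_measurable M"
    by (rule young_measurable[OF Y]) (use \<alpha> in auto)
  obtain B :: "nat \<Rightarrow> 'a set" where B: "range B \<subseteq> sets M" "(\<Union>i. B i) = space M"
    "\<And>i. emeasure M (B i) \<noteq> \<infinity>" "incseq B"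
    by (rule sigma_finite_incseq) (rule that)
  have [measurable]: "B n \<in> sets M" for n using B(1) by auto
  define u where "u = (\<lambda>x. \<alpha> * cmod (f x))"
  have [measurable]: "u \<in> borel_measurable M" unfolding u_def by measurable
  have u0: "u x \<ge> 0" for x using \<alpha> by (simp add: u_def)
  \<comment> \<open>Equality in Young's inequality gives
    \<open>complementary \<Phi> (s (u x)) \<le> s (u x) * u x\<close>; the two caps bound this by
    \<open>n * n\<close> on a set of finite measure.\<close>
  define E where "E = (\<lambda>n::nat. {x \<in> B n. u x \<in> young_dom \<Phi> \<and> u x \<le> real n \<and> s (u x) \<le> real n})"
  have BS: "B n \<subseteq> space M" for n using B(2) by blast
  have Em [measurable]: "E n \<in> sets M" for n
  proof -
    have "E n = B n \<inter> {x \<in> space M. u x \<in> young_dom \<Phi> \<and> u x \<le> real n \<and> s (u x) \<le> real n}"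
      unfolding E_def using BS[of n] by blast
    then show ?thesis by simp
  qed
  have le1: "(\<integral>\<^sup>+x. \<Phi> (u x) * indicator (E n) x \<partial>M) \<le> 1" for n
  proof -
    define g where "g = (\<lambda>x. s (u x) * indicator (E n) x)"
    have gm [measurable]: "g \<in> borel_measurable M" unfolding g_def by measurable
    have g0: "g x \<ge> 0" for x using s(2) by (simp add: g_def)
    have gE: "complementary \<Phi> (g x) + \<Phi> (u x) * indicator (E n) x
        \<le> ennreal \<alpha> * (ennreal (cmod (f x)) * ennreal (g x))" for x
    proof (cases "x \<in> E n")
      case True
      then have "complementary \<Phi> (g x) + \<Phi> (u x) \<le> ennreal (g x * u x)"
        using s(3)[of "u x"] by (simp add: g_def E_def)
      also have "ennreal (g x * u x) = ennreal \<alpha> * (ennreal (cmod (f x)) * ennreal (g x))"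
        using \<alpha> g0 by (simp add: u_def ac_simps flip: ennreal_mult)
      finally show ?thesis using True by simp
    qed (simp add: g_def)
    have gB: "complementary \<Phi> (g x) \<le> ennreal (real n * real n) * indicator (B n) x" for x
    proof (cases "x \<in> E n")
      case True
      then have "complementary \<Phi> (g x) + \<Phi> (u x) \<le> ennreal (s (u x) * u x)"
        using s(3)[of "u x"] by (simp add: g_def E_def)
      also have "\<dots> \<le> ennreal (real n * real n)"
        using True u0 s(2) by (intro ennreal_leI mult_mono) (auto simp: E_def)
      finally have "complementary \<Phi> (g x) \<le> ennreal (real n * real n)"
        by (rule order_trans[rotated]) simp
      then show ?thesis using True by (simp add: E_def)
    qed (simp add: g_def)
    define \<rho> where "\<rho> = (\<integral>\<^sup>+x. complementary \<Phi> (g x) \<partial>M)"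
    define J where "J = (\<integral>\<^sup>+x. \<Phi> (u x) * indicator (E n) x \<partial>M)"
    have "\<rho> \<le> (\<integral>\<^sup>+x. ennreal (real n * real n) * indicator (B n) x \<partial>M)"
      unfolding \<rho>_def by (intro nn_integral_mono gB)
    also have "\<dots> < \<infinity>"
      using B(3)[of n] by (simp add: nn_integral_cmult_indicator ennreal_mult_less_top less_top)
    finally obtain r where r: "r \<ge> 0" "\<rho> = ennreal r" by (cases \<rho> rule: ennreal_cases) auto
    define R where "R = max 1 r"
    have R: "R \<ge> 1" "R \<ge> r" by (auto simp: R_def)
    have "(\<integral>\<^sup>+x. complementary \<Phi> (1 / R * g x) \<partial>M) \<le> (\<integral>\<^sup>+x. ennreal (1 / R) * complementary \<Phi> (g x) \<partial>M)"
      using R by (intro nn_integral_mono complementary_scale[OF Y]) auto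
    also have "\<dots> = ennreal (r / R)"
      using R r by (simp add: nn_integral_cmult \<rho>_def[symmetric] flip: ennreal_mult)
    also have "\<dots> \<le> 1" using R r by simp
    finally have "(\<integral>\<^sup>+x. ennreal (cmod (f x)) * ennreal (1 / R * g x) \<partial>M) \<le> 1"
      using N g0 R unfolding orlicz_norm_eq_nn by (intro order_trans[OF orlicz_norm_nn_upper]) auto
    also have "(\<integral>\<^sup>+x. ennreal (cmod (f x)) * ennreal (1 / R * g x) \<partial>M)
        = ennreal (1 / R) * (\<integral>\<^sup>+x. ennreal (cmod (f x)) * ennreal (g x) \<partial>M)"
      using R g0 by (subst nn_integral_cmult[symmetric])
        (auto intro!: nn_integral_cong simp: ac_simps simp flip: ennreal_mult)
    finally have "ennreal R * (ennreal (1 / R) * (\<integral>\<^sup>+x. ennreal (cmod (f x)) * ennreal (g x) \<partial>M)) \<le> ennreal R * 1"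
      by (rule mult_left_mono) simp
    then have bound: "(\<integral>\<^sup>+x. ennreal (cmod (f x)) * ennreal (g x) \<partial>M) \<le> ennreal R"
      using R by (simp add: mult.assoc[symmetric] flip: ennreal_mult)
    have "\<rho> + J = (\<integral>\<^sup>+x. complementary \<Phi> (g x) + \<Phi> (u x) * indicator (E n) x \<partial>M)"
      unfolding \<rho>_def J_def by (subst nn_integral_add) (auto simp: u_def)
    also have "\<dots> \<le> (\<integral>\<^sup>+x. ennreal \<alpha> * (ennreal (cmod (f x)) * ennreal (g x)) \<partial>M)"
      by (intro nn_integral_mono gE)
    also have "\<dots> = ennreal \<alpha> * (\<integral>\<^sup>+x. ennreal (cmod (f x)) * ennreal (g x) \<partial>M)"
      by (rule nn_integral_cmult) measurable
    also have "\<dots> \<le> 1 * ennreal R"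
      using \<alpha> by (intro mult_mono bound) auto
    finally have *: "ennreal r + J \<le> ennreal R" using r by simp
    then have "J \<noteq> top" by (auto simp: top_unique)
    then obtain j where j: "j \<ge> 0" "J = ennreal j" by (cases J rule: ennreal_cases) auto
    have "r + j \<le> R" using * r(1) j R by (simp flip: ennreal_plus)
    \<comment> \<open>With \<open>R = max 1 r\<close>: either \<open>r \<le> 1\<close> and
      \<open>j \<le> 1 - r\<close>, or \<open>r > 1\<close> and \<open>j \<le> 0\<close>.\<close>
    then have "j \<le> 1" using r(1) by (simp add: R_def max_def split: if_splits)
    then show ?thesis using j unfolding J_def by simp
  qed
  have \<Phi>u: "(\<lambda>x. \<Phi> (u x)) \<in> borel_measurable M" using \<Phi>m by (simp add: u_def)
  \<comment> \<open>The midpoint of \<open>\<alpha>\<close> and 1 gives a finite value strictly to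
    the right of \<open>u x\<close>, as membership in \<open>young_dom\<close> demands.\<close>
  have "AE x in M. \<Phi> ((1 + \<alpha>) / 2 * cmod (f x)) < \<infinity>"
    by (rule AE_young_finite[OF Y _ N]) (use \<alpha> in auto)
  with AE_space have "AE x in M. \<Phi> (u x) = (SUP n. \<Phi> (u x) * indicator (E n) x)"
  proof eventually_elim
    fix x assume x: "x \<in> space M" "\<Phi> ((1 + \<alpha>) / 2 * cmod (f x)) < \<infinity>"
    show "\<Phi> (u x) = (SUP n. \<Phi> (u x) * indicator (E n) x)"
    proof (cases "f x = 0")
      case True
      then show ?thesis using young_zero[OF Y] by (simp add: u_def)
    next
      case False
      then have "u x \<in> young_dom \<Phi>" using \<alpha> x(2) unfolding young_dom_def u_def
        by (auto intro!: exI[of _ "(1 + \<alpha>) / 2 * cmod (f x)"])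
      moreover obtain k where k: "x \<in> B k" using B(2) x(1) by auto
      moreover obtain m :: nat where m: "max (u x) (s (u x)) \<le> real m"
        using real_arch_simple by blast
      ultimately have "x \<in> E (max k m)"
        using incseqD[OF B(4), of k "max k m"] by (auto simp: E_def)
      then have "\<Phi> (u x) \<le> (SUP n. \<Phi> (u x) * indicator (E n) x)"
        by (intro SUP_upper2[of "max k m"]) auto
      then show ?thesis by (intro antisym SUP_least) (auto simp: indicator_def)
    qed
  qed
  then have "(\<integral>\<^sup>+x. \<Phi> (u x) \<partial>M) = (\<integral>\<^sup>+x. (SUP n. \<Phi> (u x) * indicator (E n) x) \<partial>M)"
    by (rule nn_integral_cong_AE)
  also have "\<dots> = (SUP n. \<integral>\<^sup>+x. \<Phi> (u x) * indicator (E n) x \<partial>M)"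
  proof (rule nn_integral_monotone_convergence_SUP)
    show "incseq (\<lambda>n x. \<Phi> (u x) * indicator (E n) x)"
      using incseqD[OF B(4)] by (intro incseq_SucI le_funI mult_left_mono)
        (auto simp: E_def indicator_def incseq_Suc_iff intro: incseq_SucD[OF B(4), THEN subsetD])
  qed (use \<Phi>u in measurable)
  also have "\<dots> \<le> 1" by (intro SUP_least le1)
  finally show ?thesis by (simp add: u_def)
qed

lemma (in sigma_finite_measure) modular_scaled_le_one:
  assumes Y: "young_function \<Phi>" and f [measurable]: "f \<in> borel_measurable M"
    and N: "orlicz_norm \<Phi> M f < ennreal c"
  shows "(\<integral>\<^sup>+x. \<Phi> (cmod (f x) / c) \<partial>M) \<le> 1"
proof -
  obtain b where b: "0 \<le> b" "orlicz_norm \<Phi> M f = ennreal b"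
    using N by (cases "orlicz_norm \<Phi> M f" rule: ennreal_cases) auto
  with N have "b < c" by (simp add: ennreal_less_iff)
  \<comment> \<open>Dividing by \<open>d\<close> brings the norm to at most 1, and
    \<open>d / c < 1\<close> serves as the lost factor; the midpoint is positive even when
    \<open>b = 0\<close>.\<close>
  define d where "d = (b + c) / 2"
  have d: "b \<le> d" "d < c" "0 < d" using b \<open>b < c\<close> by (auto simp: d_def)
  have "orlicz_norm \<Phi> M (\<lambda>x. complex_of_real (1 / d) * f x) = ennreal (b / d)"
    using b d by (subst orlicz_norm_cmult[OF f]) (simp add: norm_divide flip: ennreal_mult)
  also have "\<dots> \<le> 1" using b d by simp
  finally have "(\<integral>\<^sup>+x. \<Phi> (d / c * cmod (complex_of_real (1 / d) * f x)) \<partial>M) \<le> 1"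
    using d by (intro modular_le_one[OF Y]) auto
  then show ?thesis using d by (simp add: norm_mult norm_divide)
qed

text \<open>Replaces the modular in the definition of the space by a seminorm, for which sums and
  scalar multiples are immediate.\<close>

lemma (in sigma_finite_measure) orlicz_space_iff:
  assumes Y: "young_function \<Phi>"
  shows "f \<in> orlicz_space \<Phi> M \<longleftrightarrow> f \<in> borel_measurable M \<and> orlicz_norm \<Phi> M f < \<infinity>"
proof safe
  assume "f \<in> orlicz_space \<Phi> M"
  then obtain \<alpha> where f [measurable]: "f \<in> borel_measurable M" and \<alpha>: "\<alpha> > 0"
    "(\<integral>\<^sup>+x. \<Phi> (\<alpha> * cmod (f x)) \<partial>M) < \<infinity>" by (auto simp: orlicz_space_def)
  show "f \<in> borel_measurable M" by (rule f)
  have "ennreal \<alpha> * orlicz_norm \<Phi> M f = orlicz_norm \<Phi> M (\<lambda>x. complex_of_real \<alpha> * f x)"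
    using \<alpha> by (subst orlicz_norm_cmult[OF f]) simp
  also have "\<dots> \<le> (\<integral>\<^sup>+x. \<Phi> (cmod (complex_of_real \<alpha> * f x)) \<partial>M) + 1"
    by (rule orlicz_norm_le_modular[OF Y]) measurable
  also have "\<dots> < \<infinity>" using \<alpha> by (simp add: norm_mult)
  finally show "orlicz_norm \<Phi> M f < \<infinity>"
    using \<alpha>(1) by (auto simp: ennreal_mult_less_top)
next
  assume f: "f \<in> borel_measurable M" "orlicz_norm \<Phi> M f < \<infinity>"
  then obtain b where b: "0 \<le> b" "orlicz_norm \<Phi> M f = ennreal b"
    by (cases "orlicz_norm \<Phi> M f" rule: ennreal_cases) auto
  then have "(\<integral>\<^sup>+x. \<Phi> (cmod (f x) / (b + 1)) \<partial>M) \<le> 1"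
    by (intro modular_scaled_le_one[OF Y f(1)]) (simp add: ennreal_less_iff)
  then have "(\<integral>\<^sup>+x. \<Phi> (1 / (b + 1) * cmod (f x)) \<partial>M) < \<infinity>"
    by (simp add: order_le_less_trans[OF _ ennreal_one_less_top])
  moreover have "1 / (b + 1) > 0" using b(1) by simp
  ultimately show "f \<in> orlicz_space \<Phi> M"
    unfolding orlicz_space_def using f(1) by blast
qed

section \<open>Series in Orlicz spaces\<close>

lemma ennreal_tendsto_0_le:
  fixes f g :: "'a \<Rightarrow> ennreal"
  assumes "(g \<longlongrightarrow> 0) F" "eventually (\<lambda>x. f x \<le> g x) F"
  shows "(f \<longlongrightarrow> 0) F"
  by (rule tendsto_sandwich[OF _ assms(2) tendsto_const assms(1)]) simp

text \<open>\<open>\<Phi>\<close> is at least 1 at some \<open>K\<close>, so by convexity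
  \<open>\<Phi> t \<ge> t / K\<close> beyond \<open>K\<close>. For \<open>y \<le> 1 / K\<close> the
  product \<open>t * y\<close> therefore exceeds \<open>\<Phi> t\<close> at most for
  \<open>t \<le> K\<close>, where it is at most \<open>K * y\<close>.\<close>

lemma complementary_linear_near_zero:
  assumes Y: "young_function \<Phi>"
  obtains K c :: real where "0 < K" "0 < c"
    "\<And>y. 0 \<le> y \<Longrightarrow> y \<le> c \<Longrightarrow> complementary \<Phi> y \<le> ennreal (K * y)"
proof -
  have "eventually (\<lambda>x. 1 < \<Phi> x) at_top"
    using Y unfolding young_function_def by (intro order_tendstoD(1)[where y = \<infinity>]) auto
  then obtain x0 where x0: "\<And>x. x \<ge> x0 \<Longrightarrow> 1 < \<Phi> x" by (auto simp: eventually_at_top_linorder)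
  define K where "K = max 1 x0"
  have K: "K > 0" "1 \<le> \<Phi> K" using x0[of K] by (auto simp: K_def less_imp_le)
  show thesis
  proof (rule that[of K "1 / K"])
    fix y :: real assume y: "0 \<le> y" "y \<le> 1 / K"
    show "complementary \<Phi> y \<le> ennreal (K * y)"
    proof (rule complementary_leI)
      fix t :: real assume t: "0 < t"
      show "ennreal (t * y) \<le> \<Phi> t + ennreal (K * y)"
      proof (cases "t \<le> K")
        case True
        then show ?thesis using y by (intro add_increasing ennreal_leI mult_right_mono) auto
      next
        case False
        have "ennreal (t * y) \<le> ennreal (t / K) * 1"
          using y t K(1) mult_left_mono[OF y(2), of t] by (simp add: ennreal_leI)
        also have "\<dots> \<le> ennreal (t / K) * \<Phi> (K / t * t)"
          using t K by (intro mult_left_mono) auto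
        also have "\<dots> \<le> ennreal (t / K) * (ennreal (K / t) * \<Phi> t)"
          using False K t by (intro mult_left_mono young_scale[OF Y]) auto
        also have "\<dots> = \<Phi> t"
          using K t by (simp add: mult.assoc[symmetric] flip: ennreal_mult)
        finally show ?thesis by (rule add_increasing2[rotated]) simp
      qed
    qed
  qed (use K in auto)
qed

text \<open>On a finite measure space a small positive constant \<open>e\<close> is an admissible
  test function; testing with it gives \<open>C = 1 / e\<close>.\<close>

lemma (in finite_measure) integral_le_orlicz_norm:
  assumes Y: "young_function \<Phi>"
  obtains C :: real where "0 < C"
    "\<And>h. h \<in> borel_measurable M \<Longrightarrow> (\<integral>\<^sup>+x. h x \<partial>M) \<le> ennreal C * orlicz_norm_nn \<Phi> M h"
proof -
  obtain K c :: real where Kc: "0 < K" "0 < c"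
    "\<And>y. 0 \<le> y \<Longrightarrow> y \<le> c \<Longrightarrow> complementary \<Phi> y \<le> ennreal (K * y)"
    by (rule complementary_linear_near_zero[OF Y]) (rule that)
  define m where "m = measure M (space M)"
  have m: "emeasure M (space M) = ennreal m" "m \<ge> 0" by (auto simp: m_def emeasure_eq_measure)
  \<comment> \<open>Chosen so that \<open>K * e * m \<le> 1\<close>; \<open>m + 1\<close> keeps the
    denominator positive when the measure is 0.\<close>
  define e where "e = min c (1 / (K * (m + 1)))"
  have e: "e > 0" "e \<le> c" using Kc m by (auto simp: e_def)
  have "K * e * (m + 1) = K * (m + 1) * e" by simp
  also have "\<dots> \<le> K * (m + 1) * (1 / (K * (m + 1)))"
    using Kc(1) m(2) by (intro mult_left_mono) (auto simp: e_def)
  also have "\<dots> = 1" using Kc(1) m(2) by simp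
  finally have "K * e * (m + 1) \<le> 1" .
  moreover have "K * e * m \<le> K * e * (m + 1)" using Kc(1) e(1) m(2) by (intro mult_left_mono) auto
  ultimately have Kem: "K * e * m \<le> 1" by simp
  have "(\<integral>\<^sup>+x. complementary \<Phi> e \<partial>M) = complementary \<Phi> e * ennreal m" by (simp add: m)
  also have "\<dots> \<le> ennreal (K * e) * ennreal m"
    using Kc(3)[of e] e by (intro mult_right_mono) auto
  also have "\<dots> = ennreal (K * e * m)" using Kc e m by (simp add: ennreal_mult)
  also have "\<dots> \<le> 1" using Kem by simp
  finally have test: "(\<integral>\<^sup>+x. complementary \<Phi> e \<partial>M) \<le> 1" .
  show thesis
  proof (rule that[of "1 / e"])
    fix h :: "'a \<Rightarrow> ennreal" assume [measurable]: "h \<in> borel_measurable M"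
    have "ennreal (1 / e) * ennreal e = 1" using e by (simp flip: ennreal_mult)
    then have "(\<integral>\<^sup>+x. h x \<partial>M) = ennreal (1 / e) * ((\<integral>\<^sup>+x. h x \<partial>M) * ennreal e)"
      by (metis mult.left_commute mult.right_neutral)
    also have "(\<integral>\<^sup>+x. h x \<partial>M) * ennreal e = (\<integral>\<^sup>+x. h x * ennreal e \<partial>M)"
      by (rule nn_integral_multc[symmetric]) measurable
    also have "\<dots> \<le> orlicz_norm_nn \<Phi> M h"
      using e test by (intro orlicz_norm_nn_upper) auto
    finally show "(\<integral>\<^sup>+x. h x \<partial>M) \<le> ennreal (1 / e) * orlicz_norm_nn \<Phi> M h"
      by (simp add: mult_left_mono)
  qed (use e in auto)
qed

lemma (in finite_measure) orlicz_norm_zeroD: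
  assumes Y: "young_function \<Phi>" and [measurable]: "f \<in> borel_measurable M"
    and "orlicz_norm \<Phi> M f = 0"
  shows "AE x in M. f x = 0"
proof -
  obtain C :: real where C: "0 < C"
    "\<And>h. h \<in> borel_measurable M \<Longrightarrow> (\<integral>\<^sup>+x. h x \<partial>M) \<le> ennreal C * orlicz_norm_nn \<Phi> M h"
    by (rule integral_le_orlicz_norm[OF Y]) (rule that)
  from C(2)[of "\<lambda>x. ennreal (cmod (f x))"] have "(\<integral>\<^sup>+x. ennreal (cmod (f x)) \<partial>M) = 0"
    using assms(3) by (simp add: orlicz_norm_eq_nn)
  then show ?thesis by (subst (asm) nn_integral_0_iff_AE) auto
qed

lemma orlicz_norm_zero_AE: "AE x in M. f x = 0 \<Longrightarrow> orlicz_norm \<Phi> M f = 0"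
proof -
  assume "AE x in M. f x = 0"
  then have "orlicz_norm \<Phi> M f = orlicz_norm \<Phi> M (\<lambda>_. 0)" by (rule orlicz_norm_cong_AE)
  also have "\<dots> = 0" unfolding orlicz_norm_def by (intro antisym SUP_least) auto
  finally show ?thesis .
qed

lemma orlicz_norm_minus_commute:
  "orlicz_norm \<Phi> M (\<lambda>x. f x - g x) = orlicz_norm \<Phi> M (\<lambda>x. g x - f x)"
  by (simp add: orlicz_norm_eq_nn norm_minus_commute)

lemma orlicz_spaceD [measurable_dest]: "f \<in> orlicz_space \<Phi> M \<Longrightarrow> f \<in> borel_measurable M"
  by (simp add: orlicz_space_def)

text \<open>Makes the arbitrary choice in \<open>zak_transform\<close> harmless up to null
  sets.\<close>

lemma (in finite_measure) has_orlicz_sum_unique: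
  assumes Y: "young_function \<Phi>"
    and F: "has_orlicz_sum \<Phi> M u I F" and G: "has_orlicz_sum \<Phi> M u I G"
  shows "AE x in M. F x = G x"
proof -
  have [measurable]: "F \<in> borel_measurable M" "G \<in> borel_measurable M"
    and u [measurable]: "\<And>k. k \<in> I \<Longrightarrow> u k \<in> borel_measurable M"
    using F G by (auto simp: has_orlicz_sum_def dest: orlicz_spaceD)
  let ?S = "\<lambda>K F. orlicz_norm \<Phi> M (\<lambda>z. (\<Sum>k\<in>K. u k z) - F z)"
  have lim: "((\<lambda>K. ?S K F + ?S K G) \<longlongrightarrow> 0 + 0) (finite_subsets_at_top I)"
    using F G by (intro tendsto_add) (auto simp: has_orlicz_sum_def)
  have "eventually (\<lambda>K. orlicz_norm \<Phi> M (\<lambda>x. F x - G x) \<le> ?S K F + ?S K G) (finite_subsets_at_top I)"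
  proof (rule eventually_finite_subsets_at_top_weakI)
    fix K assume K: "finite K" "K \<subseteq> I"
    have [measurable]: "(\<lambda>z. \<Sum>k\<in>K. u k z) \<in> borel_measurable M"
      using K by (intro borel_measurable_sum u) auto
    have "orlicz_norm \<Phi> M (\<lambda>x. F x - G x)
        = orlicz_norm \<Phi> M (\<lambda>z. (F z - (\<Sum>k\<in>K. u k z)) + ((\<Sum>k\<in>K. u k z) - G z))" by simp
    also have "\<dots> \<le> orlicz_norm \<Phi> M (\<lambda>z. F z - (\<Sum>k\<in>K. u k z)) + ?S K G"
      by (rule orlicz_norm_triangle) measurable
    finally show "orlicz_norm \<Phi> M (\<lambda>x. F x - G x) \<le> ?S K F + ?S K G"
      by (subst orlicz_norm_minus_commute[of _ _ _ F])
  qed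
  from tendsto_lowerbound[OF lim this] have "orlicz_norm \<Phi> M (\<lambda>x. F x - G x) = 0" by simp
  from orlicz_norm_zeroD[OF Y _ this] show ?thesis by simp
qed

lemma (in sigma_finite_measure) orlicz_space_lincomb:
  assumes Y: "young_function \<Phi>" and f: "f \<in> orlicz_space \<Phi> M" and g: "g \<in> orlicz_space \<Phi> M"
  shows "(\<lambda>x. a * f x + b * g x) \<in> orlicz_space \<Phi> M"
proof -
  have [measurable]: "f \<in> borel_measurable M" "g \<in> borel_measurable M"
    using f g by (auto dest: orlicz_spaceD)
  have "orlicz_norm \<Phi> M (\<lambda>x. a * f x + b * g x)
      \<le> orlicz_norm \<Phi> M (\<lambda>x. a * f x) + orlicz_norm \<Phi> M (\<lambda>x. b * g x)"
    by (rule orlicz_norm_triangle) measurable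
  also have "\<dots> < \<infinity>"
    using f g by (simp add: orlicz_norm_cmult orlicz_space_iff[OF Y] ennreal_mult_less_top)
  finally show ?thesis by (simp add: orlicz_space_iff[OF Y])
qed

lemma (in sigma_finite_measure) has_orlicz_sum_lincomb:
  assumes Y: "young_function \<Phi>"
    and F: "has_orlicz_sum \<Phi> M u I F" and G: "has_orlicz_sum \<Phi> M v I G"
  shows "has_orlicz_sum \<Phi> M (\<lambda>k x. a * u k x + b * v k x) I (\<lambda>x. a * F x + b * G x)"
proof -
  have [measurable]: "F \<in> borel_measurable M" "G \<in> borel_measurable M"
    and u [measurable]: "\<And>k. k \<in> I \<Longrightarrow> u k \<in> borel_measurable M"
    and v [measurable]: "\<And>k. k \<in> I \<Longrightarrow> v k \<in> borel_measurable M"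
    using F G by (auto simp: has_orlicz_sum_def dest: orlicz_spaceD)
  let ?S = "\<lambda>K u F. orlicz_norm \<Phi> M (\<lambda>z. (\<Sum>k\<in>K. u k z) - F z)"
  have lim: "((\<lambda>K. ennreal (cmod a) * ?S K u F + ennreal (cmod b) * ?S K v G)
      \<longlongrightarrow> ennreal (cmod a) * 0 + ennreal (cmod b) * 0) (finite_subsets_at_top I)"
    using F G by (intro tendsto_add ennreal_tendsto_cmult) (auto simp: has_orlicz_sum_def)
  have "eventually (\<lambda>K. ?S K (\<lambda>k x. a * u k x + b * v k x) (\<lambda>x. a * F x + b * G x)
      \<le> ennreal (cmod a) * ?S K u F + ennreal (cmod b) * ?S K v G) (finite_subsets_at_top I)"
  proof (rule eventually_finite_subsets_at_top_weakI)
    fix K assume K: "finite K" "K \<subseteq> I"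
    have [measurable]: "(\<lambda>z. \<Sum>k\<in>K. u k z) \<in> borel_measurable M" "(\<lambda>z. \<Sum>k\<in>K. v k z) \<in> borel_measurable M"
      using K by (auto intro!: borel_measurable_sum u v)
    have "?S K (\<lambda>k x. a * u k x + b * v k x) (\<lambda>x. a * F x + b * G x)
       = orlicz_norm \<Phi> M (\<lambda>z. a * ((\<Sum>k\<in>K. u k z) - F z) + b * ((\<Sum>k\<in>K. v k z) - G z))"
      by (rule arg_cong[where f = "orlicz_norm \<Phi> M"])
        (simp add: fun_eq_iff sum.distrib sum_distrib_left algebra_simps)
    also have "\<dots> \<le> orlicz_norm \<Phi> M (\<lambda>z. a * ((\<Sum>k\<in>K. u k z) - F z))
        + orlicz_norm \<Phi> M (\<lambda>z. b * ((\<Sum>k\<in>K. v k z) - G z))"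
      by (rule orlicz_norm_triangle) measurable
    also have "\<dots> = ennreal (cmod a) * ?S K u F + ennreal (cmod b) * ?S K v G"
      by (subst (1 2) orlicz_norm_cmult) auto
    finally show "?S K (\<lambda>k x. a * u k x + b * v k x) (\<lambda>x. a * F x + b * G x) \<le> \<dots>" .
  qed
  then have "((\<lambda>K. ?S K (\<lambda>k x. a * u k x + b * v k x) (\<lambda>x. a * F x + b * G x)) \<longlongrightarrow> 0)
      (finite_subsets_at_top I)"
    by (rule ennreal_tendsto_0_le[OF lim[simplified]])
  with F G show ?thesis
    by (auto simp: has_orlicz_sum_def orlicz_space_lincomb[OF Y])
qed

text \<open>Dominated convergence handles the initial segments of an enumeration. Tails shrink as
  \<open>K\<close> grows, so this one sequence controls the whole net of finite subsets.\<close>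

lemma count_space_tail_tendsto_zero:
  fixes a :: "'i \<Rightarrow> ennreal"
  assumes I: "countable I" and fin: "(\<integral>\<^sup>+i. a i \<partial>count_space I) < \<infinity>"
  shows "((\<lambda>K. \<integral>\<^sup>+i. a i * indicator (- K) i \<partial>count_space I) \<longlongrightarrow> 0) (finite_subsets_at_top I)"
proof -
  define B where "B = (\<lambda>n. {i \<in> I. to_nat_on I i < n})"
  have Bfin: "finite (B n)" for n
  proof (rule inj_on_finite[where f = "to_nat_on I" and B = "{..<n}"])
    show "inj_on (to_nat_on I) (B n)"
      using inj_on_to_nat_on[OF I] by (rule inj_on_subset) (auto simp: B_def)
  qed (auto simp: B_def)
  have "(\<lambda>n. \<integral>\<^sup>+i. a i * indicator (- B n) i \<partial>count_space I) \<longlonglongrightarrow> (\<integral>\<^sup>+i. 0 \<partial>count_space I)"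
  proof (rule nn_integral_dominated_convergence[where w = a])
    show "AE i in count_space I. (\<lambda>n. a i * indicator (- B n) i) \<longlonglongrightarrow> 0"
    proof (rule AE_I2)
      fix i assume "i \<in> space (count_space I)"
      then have "eventually (\<lambda>n. a i * indicator (- B n) i = 0) sequentially"
        by (intro eventually_mono[OF eventually_gt_at_top[of "to_nat_on I i"]]) (simp add: B_def)
      then show "(\<lambda>n. a i * indicator (- B n) i) \<longlonglongrightarrow> 0" by (rule tendsto_eventually)
    qed
  qed (use fin in \<open>auto simp: indicator_def\<close>)
  then have lim: "(\<lambda>n. \<integral>\<^sup>+i. a i * indicator (- B n) i \<partial>count_space I) \<longlonglongrightarrow> 0" by simp
  show ?thesis
  proof (rule order_tendstoI)
    fix e :: ennreal assume "0 < e"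
    then obtain n where n: "(\<integral>\<^sup>+i. a i * indicator (- B n) i \<partial>count_space I) < e"
      using order_tendstoD(2)[OF lim, of e] by (auto simp: eventually_sequentially)
    have "(\<integral>\<^sup>+i. a i * indicator (- K) i \<partial>count_space I) < e" if "B n \<subseteq> K" for K
      using that by (intro le_less_trans[OF nn_integral_mono n] mult_left_mono) (auto simp: indicator_def)
    then show "eventually (\<lambda>K. (\<integral>\<^sup>+i. a i * indicator (- K) i \<partial>count_space I) < e) (finite_subsets_at_top I)"
      unfolding eventually_finite_subsets_at_top using Bfin[of n]
      by (intro exI[of _ "B n"]) (auto simp: B_def)
  qed simp
qed

text \<open>Stands in for completeness: the sum is built pointwise. The sum \<open>S\<close> of the
  moduli has finite Orlicz norm, so it is integrable and finite almost everywhere; where it is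
  finite the series converges absolutely, and the remainder beyond \<open>K\<close> is estimated by
  the infinite triangle inequality.\<close>

lemma (in finite_measure) absolutely_summable_has_orlicz_sum:
  assumes Y: "young_function \<Phi>" and I: "countable I"
    and u: "\<And>k. k \<in> I \<Longrightarrow> u k \<in> borel_measurable M"
    and fin: "(\<integral>\<^sup>+k. orlicz_norm \<Phi> M (u k) \<partial>count_space I) < \<infinity>"
  shows "\<exists>F. has_orlicz_sum \<Phi> M u I F \<and>
    orlicz_norm \<Phi> M F \<le> (\<integral>\<^sup>+k. orlicz_norm \<Phi> M (u k) \<partial>count_space I)"
proof -
  note [measurable] = u
  obtain C :: real where C: "0 < C"
    "\<And>h. h \<in> borel_measurable M \<Longrightarrow> (\<integral>\<^sup>+x. h x \<partial>M) \<le> ennreal C * orlicz_norm_nn \<Phi> M h"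
    by (rule integral_le_orlicz_norm[OF Y]) (rule that)
  interpret cs: sigma_finite_measure "count_space I"
    by (rule sigma_finite_measure_count_space_countable[OF I])
  have pm [measurable]: "(\<lambda>(x, k). u k x) \<in> borel_measurable (M \<Otimes>\<^sub>M count_space I)"
    using measurable_pair_swap[OF measurable_pair_measure_countable1[OF I, of "\<lambda>(k, x). u k x" M borel]] u
    by simp
  \<comment> \<open>The Bochner integral over the index set is the pointwise sum, with default value
    0 on the null set where the series is not absolutely summable.\<close>
  define F where "F = (\<lambda>x. \<integral>k. u k x \<partial>count_space I)"
  have Fm [measurable]: "F \<in> borel_measurable M"
    unfolding F_def using pm by (rule cs.borel_measurable_lebesgue_integral)
  define S where "S = (\<lambda>x. \<integral>\<^sup>+k. ennreal (cmod (u k x)) \<partial>count_space I)"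
  have Sm [measurable]: "S \<in> borel_measurable M"
    unfolding S_def by (rule cs.borel_measurable_nn_integral) measurable
  have "orlicz_norm_nn \<Phi> M S \<le> (\<integral>\<^sup>+k. orlicz_norm \<Phi> M (u k) \<partial>count_space I)"
    unfolding S_def orlicz_norm_eq_nn by (intro orlicz_norm_nn_countable_sum I) measurable
  with fin have "orlicz_norm_nn \<Phi> M S < \<infinity>" by (rule le_less_trans[rotated])
  then have "(\<integral>\<^sup>+x. S x \<partial>M) < \<infinity>"
    using C(2)[OF Sm] by (simp add: ennreal_mult_less_top le_less_trans)
  then have "AE x in M. S x \<noteq> \<infinity>"
    by (intro nn_integral_noteq_infinite) auto
  then have int: "AE x in M. integrable (count_space I) (\<lambda>k. u k x)"
    by eventually_elim (auto simp: integrable_iff_bounded S_def less_top)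
  have tail: "orlicz_norm \<Phi> M (\<lambda>z. (\<Sum>k\<in>K. u k z) - F z)
      \<le> (\<integral>\<^sup>+k. orlicz_norm \<Phi> M (u k) * indicator (- K) k \<partial>count_space I)"
    if K: "finite K" "K \<subseteq> I" for K
  proof -
    have "AE z in M. ennreal (cmod ((\<Sum>k\<in>K. u k z) - F z))
        \<le> (\<integral>\<^sup>+k. indicator (- K) k * ennreal (cmod (u k z)) \<partial>count_space I)"
      using int
    proof eventually_elim
      fix z assume iz: "integrable (count_space I) (\<lambda>k. u k z)"
      have iK: "integrable (count_space I) (\<lambda>k. u k z * indicator A k)" for A
        by (rule Bochner_Integration.integrable_bound[OF iz]) (auto simp: indicator_def)
      have "(\<integral>k. u k z * indicator K k \<partial>count_space I) = (\<Sum>k | k \<in> I \<and> u k z * indicator K k \<noteq> 0. u k z * indicator K k)"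
        using K by (intro lebesgue_integral_count_space_finite_support)
          (auto intro: finite_subset[of _ K] simp: indicator_def)
      also have "\<dots> = (\<Sum>k\<in>K. u k z * indicator K k)"
        using K by (intro sum.mono_neutral_left) (auto simp: indicator_def)
      also have "\<dots> = (\<Sum>k\<in>K. u k z)" by (intro sum.cong) auto
      finally have "(\<Sum>k\<in>K. u k z) = (\<integral>k. u k z * indicator K k \<partial>count_space I)" ..
      moreover have "F z = (\<integral>k. u k z * indicator K k + u k z * indicator (- K) k \<partial>count_space I)"
        unfolding F_def by (intro Bochner_Integration.integral_cong) (auto simp: indicator_def)
      ultimately have "F z - (\<Sum>k\<in>K. u k z) = (\<integral>k. u k z * indicator (- K) k \<partial>count_space I)"
        using iK by (simp add: Bochner_Integration.integral_add)
      then have "ennreal (cmod (F z - (\<Sum>k\<in>K. u k z)))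
          \<le> (\<integral>\<^sup>+k. ennreal (cmod (u k z * indicator (- K) k)) \<partial>count_space I)"
        using integral_norm_bound_ennreal[OF iK[of "- K"]] by simp
      also have "\<dots> = (\<integral>\<^sup>+k. indicator (- K) k * ennreal (cmod (u k z)) \<partial>count_space I)"
        by (intro nn_integral_cong) (auto simp: indicator_def)
      finally show "ennreal (cmod ((\<Sum>k\<in>K. u k z) - F z)) \<le> \<dots>" by (simp add: norm_minus_commute)
    qed
    then have "orlicz_norm \<Phi> M (\<lambda>z. (\<Sum>k\<in>K. u k z) - F z)
        \<le> orlicz_norm_nn \<Phi> M (\<lambda>z. \<integral>\<^sup>+k. indicator (- K) k * ennreal (cmod (u k z)) \<partial>count_space I)"
      unfolding orlicz_norm_eq_nn by (rule orlicz_norm_nn_mono_AE)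
    also have "\<dots> \<le> (\<integral>\<^sup>+k. orlicz_norm_nn \<Phi> M (\<lambda>z. indicator (- K) k * ennreal (cmod (u k z))) \<partial>count_space I)"
      by (intro orlicz_norm_nn_countable_sum I) measurable
    also have "\<dots> = (\<integral>\<^sup>+k. orlicz_norm \<Phi> M (u k) * indicator (- K) k \<partial>count_space I)"
      by (intro nn_integral_cong) (simp add: orlicz_norm_nn_cmult orlicz_norm_eq_nn mult.commute)
    finally show ?thesis .
  qed
  \<comment> \<open>The empty partial sum in the tail estimate.\<close>
  have nF: "orlicz_norm \<Phi> M F \<le> (\<integral>\<^sup>+k. orlicz_norm \<Phi> M (u k) \<partial>count_space I)"
    using tail[of "{}"] by (simp add: orlicz_norm_eq_nn)
  have "((\<lambda>K. orlicz_norm \<Phi> M (\<lambda>z. (\<Sum>k\<in>K. u k z) - F z)) \<longlongrightarrow> 0) (finite_subsets_at_top I)"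
    by (rule ennreal_tendsto_0_le[OF count_space_tail_tendsto_zero[OF I fin]
          eventually_finite_subsets_at_top_weakI]) (rule tail)
  moreover have "F \<in> orlicz_space \<Phi> M"
    using order_le_less_trans[OF nF fin] Fm by (simp add: orlicz_space_iff[OF Y])
  moreover have "u k \<in> orlicz_space \<Phi> M" if k: "k \<in> I" for k
  proof -
    have "orlicz_norm \<Phi> M (u k) = (\<integral>\<^sup>+i. orlicz_norm \<Phi> M (u k) * indicator {k} i \<partial>count_space I)"
      using k by (simp add: nn_integral_cmult)
    also have "\<dots> \<le> (\<integral>\<^sup>+i. orlicz_norm \<Phi> M (u i) \<partial>count_space I)"
      by (intro nn_integral_mono) (auto simp: indicator_def)
    finally have "orlicz_norm \<Phi> M (u k) < \<infinity>" using fin by (rule order_le_less_trans)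
    then show ?thesis using u[OF k] by (simp add: orlicz_space_iff[OF Y])
  qed
  ultimately show ?thesis using nF by (auto simp: has_orlicz_sum_def)
qed

section \<open>Wiener amalgam spaces\<close>

lemma sigma_finite_lebesgue: "sigma_finite_measure (lebesgue :: 'a::euclidean_space measure)"
proof
  obtain A :: "'a set set" where A: "countable A" "A \<subseteq> sets lborel" "\<Union>A = space lborel"
    "\<forall>a\<in>A. emeasure lborel a \<noteq> \<infinity>"
    using lborel.sigma_finite_countable by blast
  then have "\<forall>a\<in>A. emeasure lebesgue a \<noteq> \<infinity>" by (auto simp: subset_eq)
  then show "\<exists>A::'a set set. countable A \<and> A \<subseteq> sets lebesgue \<and> \<Union>A = space lebesgue \<and>
      (\<forall>a\<in>A. emeasure lebesgue a \<noteq> \<infinity>)"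
    using A by (intro exI[of _ A]) auto
qed

text \<open>Outer regularity gives an open \<open>T\<close> around \<open>S\<close> with
  \<open>T - S\<close> small, and by compactness small translates of \<open>S\<close> stay in
  \<open>T\<close>. This bounds the translate minus \<open>S\<close>; the two sets have the same
  finite measure, so the opposite difference has the same measure.\<close>

lemma compact_translate_diff_small:
  fixes S :: "'a::euclidean_space set"
  assumes S: "compact S" and "0 < e"
  obtains \<delta> where "0 < \<delta>"
    "\<And>v. norm v < \<delta> \<Longrightarrow> emeasure lebesgue (S - (\<lambda>y. y + v) ` S) < ennreal e"
proof -
  have Sm: "S \<in> lmeasurable" by (rule lmeasurable_compact[OF S])
  obtain T where T: "open T" "S \<subseteq> T" "T - S \<in> lmeasurable" "emeasure lebesgue (T - S) < ennreal e"
    using sets_lebesgue_outer_open[OF fmeasurableD[OF Sm] \<open>0 < e\<close>] by blast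
  obtain \<delta> where \<delta>: "\<delta> > 0" "(\<Union>x\<in>S. ball x \<delta>) \<subseteq> T"
    using compact_subset_open_imp_ball_epsilon_subset[OF S T(1,2)] by blast
  show thesis
  proof (rule that[OF \<delta>(1)])
    fix v :: 'a assume v: "norm v < \<delta>"
    define S' where "S' = (\<lambda>y. y + v) ` S"
    have S'_eq: "S' = (+) v ` S" by (auto simp: S'_def add.commute)
    have S'm: "S' \<in> lmeasurable" unfolding S'_eq by (rule measurable_translation[OF Sm])
    have eq: "measure lebesgue S' = measure lebesgue S" unfolding S'_eq by (rule measure_translation)
    have "S' \<subseteq> T"
    proof
      fix y assume "y \<in> S'"
      then obtain x where "x \<in> S" "y = x + v" by (auto simp: S'_def)
      moreover from this have "y \<in> ball x \<delta>" using v by (simp add: dist_norm)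
      ultimately show "y \<in> T" using \<delta>(2) by blast
    qed
    then have "emeasure lebesgue (S' - S) \<le> emeasure lebesgue (T - S)"
      using T(3) by (intro emeasure_mono) auto
    moreover have "emeasure lebesgue (S - S') = emeasure lebesgue (S' - S)"
    proof -
      have "measure lebesgue (A - B) = measure lebesgue A - measure lebesgue (A \<inter> B)"
        if "A \<in> lmeasurable" "B \<in> lmeasurable" for A B :: "'a set"
        using measurable_measure_Diff[of A lebesgue "A \<inter> B"] that
        by (simp add: Diff_Int fmeasurableD fmeasurable.Int)
      from this[OF Sm S'm] this[OF S'm Sm]
      have "measure lebesgue (S - S') = measure lebesgue (S' - S)" using eq by (simp add: Int_commute)
      then show ?thesis using Sm S'm by (simp add: emeasure_eq_measure2 fmeasurable.Diff)
    qed
    ultimately show "emeasure lebesgue (S - (\<lambda>y. y + v) ` S) < ennreal e"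
      using T(4) unfolding S'_def by simp
  qed
qed

text \<open>
  Lower semicontinuity survives the supremum over all test functions, which gives the measurability
  required in the amalgam space.
\<close>

lemma translate_integral_lsc:
  fixes Q :: "'a::euclidean_space set" and h :: "'a \<Rightarrow> ennreal"
  assumes Q: "compact Q" and [measurable]: "h \<in> borel_measurable lebesgue"
  shows "open {x. c < (\<integral>\<^sup>+y. h y * indicator ((\<lambda>q. q + x) ` Q) y \<partial>lebesgue)}"
proof -
  have cmp: "compact ((\<lambda>q. q + x) ` Q)" for x
    using compact_translation[OF Q, of x] by (simp add: add.commute image_def)
  then have Qm [measurable]: "(\<lambda>q. q + x) ` Q \<in> sets lebesgue" for x
    by (intro fmeasurableD lmeasurable_compact)
  have "\<exists>\<delta>>0. \<forall>x'. dist x' x < \<delta> \<longrightarrow> c < (\<integral>\<^sup>+y. h y * indicator ((\<lambda>q. q + x') ` Q) y \<partial>lebesgue)"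
    if x: "c < (\<integral>\<^sup>+y. h y * indicator ((\<lambda>q. q + x) ` Q) y \<partial>lebesgue)" for x
  proof -
    \<comment> \<open>After truncation at height \<open>n\<close>, passing from \<open>x\<close> to
      \<open>x'\<close> loses at most \<open>n\<close> times the measure of the part of the set that
      is left behind.\<close>
    let ?hn = "\<lambda>n y. min (h y) (ennreal (real n))"
    let ?J = "\<lambda>n x. \<integral>\<^sup>+y. ?hn n y * indicator ((\<lambda>q. q + x) ` Q) y \<partial>lebesgue"
    have SUPmin: "(SUP n. ?hn n y) = h y" for y
    proof (cases "h y" rule: ennreal_cases)
      case (real r)
      obtain n where "r \<le> real n" using real_arch_simple by blast
      with real have "h y \<le> ?hn n y" by (simp add: ennreal_leI)
      then show ?thesis by (intro antisym SUP_least SUP_upper2[of n]) auto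
    next
      case top
      then show ?thesis using ennreal_SUP_of_nat_eq_top by (simp add: min_def ennreal_of_nat_eq_real_of_nat top_unique)
    qed
    have "(\<integral>\<^sup>+y. h y * indicator ((\<lambda>q. q + x) ` Q) y \<partial>lebesgue)
        = (\<integral>\<^sup>+y. (SUP n. ?hn n y * indicator ((\<lambda>q. q + x) ` Q) y) \<partial>lebesgue)"
      by (intro nn_integral_cong) (simp add: SUP_mult_right_ennreal[symmetric] SUPmin)
    also have "\<dots> = (SUP n. ?J n x)"
    proof (intro nn_integral_monotone_convergence_SUP incseq_SucI le_funI mult_right_mono)
      show "?hn n y \<le> ?hn (Suc n) y" for n y by (intro min.mono order_refl ennreal_leI) simp
    qed auto
    finally obtain n where n: "c < ?J n x" using x by (auto simp: less_SUP_iff)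
    have cfin: "c < top" using n by (rule less_le_trans) simp
    then obtain c' where c': "c = ennreal c'" "c' \<ge> 0" by (cases c rule: ennreal_cases) auto
    obtain d where d: "c < d" "d < ?J n x" using dense[OF n] by blast
    then have "d < top" by (auto intro: less_le_trans)
    then obtain d' where d': "d = ennreal d'" "d' \<ge> 0" by (cases d rule: ennreal_cases) auto
    have cd: "c' < d'" using d(1) c' d' by (simp add: ennreal_less_iff)
    \<comment> \<open>The loss \<open>n * e\<close> must stay below the gap \<open>d' - c'\<close>;
      the 1 covers \<open>n = 0\<close>.\<close>
    define e where "e = (d' - c') / (real n + 1)"
    have e: "e > 0" "real n * e < d' - c'" using cd by (auto simp: e_def field_simps)
    obtain \<delta> where \<delta>: "0 < \<delta>" "\<And>v. norm v < \<delta> \<Longrightarrow>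
        emeasure lebesgue ((\<lambda>q. q + x) ` Q - (\<lambda>y. y + v) ` (\<lambda>q. q + x) ` Q) < ennreal e"
      by (rule compact_translate_diff_small[OF cmp e(1)]) (rule that)
    show ?thesis
    proof (intro exI[of _ \<delta>] conjI allI impI \<delta>(1))
      fix x' assume x': "dist x' x < \<delta>"
      have im: "(\<lambda>y. y + (x' - x)) ` (\<lambda>q. q + x) ` Q = (\<lambda>q. q + x') ` Q"
        by (simp add: image_image add.assoc)
      let ?D = "(\<lambda>q. q + x) ` Q - (\<lambda>q. q + x') ` Q"
      have D: "emeasure lebesgue ?D < ennreal e"
        using \<delta>(2)[of "x' - x"] x' by (simp add: im dist_norm)
      have "d \<le> ?J n x" using d(2) by simp
      also have "\<dots> \<le> (\<integral>\<^sup>+y. ?hn n y * indicator ((\<lambda>q. q + x') ` Q) y + ennreal (real n) * indicator ?D y \<partial>lebesgue)"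
        by (intro nn_integral_mono) (simp split: split_indicator)
      also have "\<dots> = ?J n x' + ennreal (real n) * emeasure lebesgue ?D"
        by (subst nn_integral_add) (auto simp: nn_integral_cmult_indicator)
      also have "\<dots> \<le> ?J n x' + ennreal (real n) * ennreal e"
        using D by (intro add_mono mult_left_mono order_refl) auto
      finally have le: "ennreal d' \<le> ?J n x' + ennreal (real n * e)"
        using d' e(1) by (simp flip: ennreal_mult)
      have "c < ?J n x'"
      proof (cases "?J n x'" rule: ennreal_cases)
        case (real r)
        then have "d' \<le> r + real n * e" using le e(1) by (simp flip: ennreal_plus)
        then show ?thesis using real c' e(2) by (simp add: ennreal_less_iff)
      qed (use cfin in simp)
      also have "\<dots> \<le> (\<integral>\<^sup>+y. h y * indicator ((\<lambda>q. q + x') ` Q) y \<partial>lebesgue)"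
        by (intro nn_integral_mono mult_right_mono) auto
      finally show "c < (\<integral>\<^sup>+y. h y * indicator ((\<lambda>q. q + x') ` Q) y \<partial>lebesgue)" .
    qed
  qed
  then show ?thesis unfolding open_dist by auto
qed


section \<open>Measurability of the local norms and linear structure of the amalgam space\<close>

lemma lebesgue_image_plus_compact:
  fixes Q :: "'a::euclidean_space set"
  assumes "compact Q"
  shows "(\<lambda>q. q + x) ` Q \<in> sets lebesgue"
  using compact_translation[OF assms, of x]
  by (intro fmeasurableD lmeasurable_compact) (simp add: add.commute image_def)

lemma restrict_translate_measurable:
  assumes "compact Q\<^sub>0" and [measurable]: "f \<in> borel_measurable lebesgue"
  shows "restrict_translate Q\<^sub>0 f x \<in> borel_measurable lebesgue"
proof -
  have [measurable]: "(\<lambda>q. q + x) ` Q\<^sub>0 \<in> sets lebesgue"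
    by (rule lebesgue_image_plus_compact[OF assms(1)])
  show ?thesis unfolding restrict_translate_def by measurable
qed

lemma restrict_translate_norm_measurable:
  fixes Q\<^sub>0 :: "'a::euclidean_space set"
  assumes Q: "compact Q\<^sub>0" and f [measurable]: "f \<in> borel_measurable lebesgue"
  shows "(\<lambda>x. orlicz_norm \<Phi> lebesgue (restrict_translate Q\<^sub>0 f x)) \<in> borel_measurable lebesgue"
proof -
  have "(\<lambda>x. orlicz_norm \<Phi> lebesgue (restrict_translate Q\<^sub>0 f x)) \<in> borel_measurable borel"
  proof (rule borel_measurableI_greater)
    fix c
    have "{x \<in> space borel. c < orlicz_norm \<Phi> lebesgue (restrict_translate Q\<^sub>0 f x)}
      = (\<Union>g \<in> orlicz_test \<Phi> lebesgue.
          {x. c < (\<integral>\<^sup>+y. ennreal (cmod (f y * g y)) * indicator ((\<lambda>q. q + x) ` Q\<^sub>0) y \<partial>lebesgue)})"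
    proof -
      have "ennreal (cmod (restrict_translate Q\<^sub>0 f x y)) * ennreal (cmod (g y)) =
          ennreal (cmod (f y * g y)) * indicator ((\<lambda>q. q + x) ` Q\<^sub>0) y" for x y and g :: "'a \<Rightarrow> complex"
        by (simp add: restrict_translate_def norm_mult ennreal_mult split: split_indicator)
      then show ?thesis by (auto simp: orlicz_norm_eq_nn orlicz_norm_nn_def less_SUP_iff)
    qed
    \<comment> \<open>The union over test functions may be uncountable; openness of each member is
      what keeps it Borel.\<close>
    also have "open \<dots>"
    proof (intro open_UN ballI translate_integral_lsc Q)
      fix g assume [measurable]: "g \<in> orlicz_test \<Phi> (lebesgue :: 'a measure)"
      show "(\<lambda>y. ennreal (cmod (f y * g y))) \<in> borel_measurable lebesgue" by measurable
    qed
    finally show "{x \<in> space borel. c < orlicz_norm \<Phi> lebesgue (restrict_translate Q\<^sub>0 f x)} \<in> sets borel"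
      by (rule borel_open)
  qed
  then show ?thesis by (intro measurable_completion) simp
qed

lemma restrict_translate_lincomb:
  "restrict_translate Q\<^sub>0 (\<lambda>y. a * f y + b * g y) x
    = (\<lambda>y. a * restrict_translate Q\<^sub>0 f x y + b * restrict_translate Q\<^sub>0 g x y)"
  by (simp add: restrict_translate_def fun_eq_iff algebra_simps)

lemma wiener_amalgam_lincomb:
  fixes Q\<^sub>0 :: "'a::euclidean_space set"
  assumes Y: "young_function \<Phi>" and Q: "compact Q\<^sub>0"
    and f: "f \<in> wiener_amalgam \<Phi> Q\<^sub>0" and g: "g \<in> wiener_amalgam \<Phi> Q\<^sub>0"
  shows "(\<lambda>x. a * f x + b * g x) \<in> wiener_amalgam \<Phi> Q\<^sub>0"
proof -
  interpret sigma_finite_measure "lebesgue :: 'a measure" by (rule sigma_finite_lebesgue)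
  have fm [measurable]: "f \<in> borel_measurable lebesgue" "g \<in> borel_measurable lebesgue"
    using f g by (auto simp: wiener_amalgam_def)
  note rm [measurable] = restrict_translate_measurable[OF Q]
  let ?N = "\<lambda>f x. orlicz_norm \<Phi> lebesgue (restrict_translate Q\<^sub>0 f x)"
  note nm [measurable] = restrict_translate_norm_measurable[OF Q]
  have "(\<integral>\<^sup>+x. ?N (\<lambda>x. a * f x + b * g x) x \<partial>lebesgue)
      \<le> (\<integral>\<^sup>+x. ennreal (cmod a) * ?N f x + ennreal (cmod b) * ?N g x \<partial>lebesgue)"
  proof (rule nn_integral_mono)
    fix x :: 'a
    have "?N (\<lambda>x. a * f x + b * g x) x
      \<le> orlicz_norm \<Phi> lebesgue (\<lambda>y. a * restrict_translate Q\<^sub>0 f x y)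
       + orlicz_norm \<Phi> lebesgue (\<lambda>y. b * restrict_translate Q\<^sub>0 g x y)"
      unfolding restrict_translate_lincomb by (rule orlicz_norm_triangle) measurable
    then show "?N (\<lambda>x. a * f x + b * g x) x \<le> ennreal (cmod a) * ?N f x + ennreal (cmod b) * ?N g x"
      by (simp add: orlicz_norm_cmult[OF rm] fm)
  qed
  also have "\<dots> = ennreal (cmod a) * (\<integral>\<^sup>+x. ?N f x \<partial>lebesgue) + ennreal (cmod b) * (\<integral>\<^sup>+x. ?N g x \<partial>lebesgue)"
    by (simp add: nn_integral_add nn_integral_cmult nm fm)
  also have "\<dots> < \<infinity>"
    using f g by (simp add: wiener_amalgam_def ennreal_mult_less_top)
  finally have "(\<integral>\<^sup>+x. ?N (\<lambda>x. a * f x + b * g x) x \<partial>lebesgue) < \<infinity>" .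
  moreover have "restrict_translate Q\<^sub>0 (\<lambda>x. a * f x + b * g x) x \<in> orlicz_space \<Phi> lebesgue" for x
    unfolding restrict_translate_lincomb
    using f g by (intro orlicz_space_lincomb[OF Y]) (auto simp: wiener_amalgam_def)
  moreover have "(\<lambda>x. a * f x + b * g x) \<in> borel_measurable lebesgue" by measurable
  ultimately show ?thesis using nm by (simp add: wiener_amalgam_def)
qed

lemma wiener_amalgam_norm_zero_AE:
  assumes "AE x in lebesgue. f x = 0"
  shows "wiener_amalgam_norm \<Phi> Q\<^sub>0 f = 0"
proof -
  have "orlicz_norm \<Phi> lebesgue (restrict_translate Q\<^sub>0 f x) = 0" for x
    by (rule orlicz_norm_zero_AE) (use assms in \<open>eventually_elim, simp add: restrict_translate_def\<close>)
  then show ?thesis by (simp add: wiener_amalgam_norm_def)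
qed

section \<open>The integer lattice and the discrete amalgam norm\<close>

lemma countable_int_lattice: "countable (int_lattice :: (real^'d) set)"
proof -
  have "int_lattice \<subseteq> range (\<lambda>g::'d \<Rightarrow> int. (\<chi> i. real_of_int (g i)) :: real^'d)"
  proof
    fix k :: "real^'d" assume "k \<in> int_lattice"
    then have "k = (\<chi> i. real_of_int \<lfloor>k $ i\<rfloor>)" by (auto simp: int_lattice_def vec_eq_iff)
    then show "k \<in> range (\<lambda>g::'d \<Rightarrow> int. (\<chi> i. real_of_int (g i)) :: real^'d)"
      by (rule range_eqI[where x = "\<lambda>i. \<lfloor>k $ i\<rfloor>"])
  qed
  then show ?thesis by (rule countable_subset) (rule countable_image, rule countableI_type)
qed

lemma int_lattice_dist:
  assumes "k \<in> int_lattice" "l \<in> int_lattice" "k \<noteq> l"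
  shows "1 \<le> dist k l"
proof -
  obtain i where i: "k $ i \<noteq> l $ i" using assms(3) by (auto simp: vec_eq_iff)
  obtain m n :: int where mn: "k $ i = of_int m" "l $ i = of_int n"
    using assms(1,2) by (auto simp: int_lattice_def Ints_def) (metis rangeE)
  then have "1 \<le> \<bar>(k - l) $ i\<bar>" using i by simp
  also have "\<dots> \<le> dist k l" unfolding dist_norm by (rule component_le_norm_cart)
  finally show ?thesis .
qed

text \<open>Distinct lattice points are at distance at least 1, so open balls of radius at most 1/2
  about their translates are disjoint.\<close>

lemma lattice_balls_multiplicity:
  fixes c x :: "real^'d"
  assumes "r \<le> 1"
  shows "(\<integral>\<^sup>+k. indicator (ball (c + k) (r / 2)) x \<partial>count_space int_lattice) \<le> (1::ennreal)"
proof (cases "\<exists>k\<in>int_lattice. x \<in> ball (c + k) (r / 2)")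
  case True
  then obtain k where k: "k \<in> int_lattice" "x \<in> ball (c + k) (r / 2)" by blast
  have "l = k" if l: "l \<in> int_lattice" "x \<in> ball (c + l) (r / 2)" for l
  proof (rule ccontr)
    assume "l \<noteq> k"
    then have "1 \<le> dist k l" using int_lattice_dist k(1) l(1) by metis
    moreover have "dist k l = dist (c + k) (c + l)" by simp
    moreover have "dist (c + k) (c + l) < r / 2 + r / 2"
      using k(2) l(2) dist_triangle2[of "c + k" "c + l" x] by simp
    ultimately show False using assms by linarith
  qed
  then have "(\<integral>\<^sup>+l. indicator (ball (c + l) (r / 2)) x \<partial>count_space int_lattice)
      \<le> (\<integral>\<^sup>+l. indicator {k} l \<partial>count_space int_lattice)"
    by (intro nn_integral_mono) (auto simp: indicator_def)
  also have "\<dots> = 1" using k by simp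
  finally show ?thesis .
next
  case False
  then have "(\<integral>\<^sup>+k. indicator (ball (c + k) (r / 2)) x \<partial>count_space int_lattice) = (0::ennreal)"
    by (subst nn_integral_0_iff_AE) (auto simp: AE_count_space indicator_def)
  then show ?thesis by simp
qed

text \<open>Take a ball of radius \<open>r\<close> about \<open>q\<close> in
  \<open>Q\<^sub>0\<close> and cover the unit cube by balls of half that radius with centres
  \<open>p\<close>. For \<open>x\<close> within \<open>r / 2\<close> of \<open>p - q + k\<close>,
  the set \<open>Q\<^sub>0 + x\<close> contains the covering ball at \<open>p + k\<close>, so
  integrating the local norm over such \<open>x\<close> bounds the norm on that ball. For fixed
  \<open>p\<close> these sets of \<open>x\<close> are disjoint as \<open>k\<close> varies, so the
  sum over \<open>k\<close> costs nothing.\<close>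

lemma discrete_norm_le_wiener_amalgam_norm:
  fixes Q\<^sub>0 :: "(real^'d) set" and a :: "real^'d"
  assumes Q: "compact Q\<^sub>0" "interior Q\<^sub>0 \<noteq> {}"
  obtains C :: real where "0 < C" "\<And>\<Phi> f. f \<in> borel_measurable lebesgue \<Longrightarrow>
    (\<integral>\<^sup>+k. orlicz_norm \<Phi> lebesgue (\<lambda>y. f y * indicator (cbox (a + k) (a + k + One)) y) \<partial>count_space int_lattice)
      \<le> ennreal C * wiener_amalgam_norm \<Phi> Q\<^sub>0 f"
proof -
  obtain q r0 where q: "r0 > 0" "ball q r0 \<subseteq> Q\<^sub>0"
    using Q(2) by (meson all_not_in_conv mem_interior)
  define r where "r = min r0 1"
  have r: "r > 0" "r \<le> 1" "ball q r \<subseteq> Q\<^sub>0" using q by (auto simp: r_def)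
  obtain J where J: "finite J" "cbox a (a + One) \<subseteq> (\<Union>p\<in>J. ball p (r / 2))"
  proof -
    have "cbox a (a + One) \<subseteq> \<Union> ((\<lambda>p. ball p (r / 2)) ` cbox a (a + One))" using r by force
    from compactE_image[OF compact_cbox _ this] show ?thesis using that by (metis open_ball)
  qed
  have ball_m [measurable]: "ball c s \<in> sets lebesgue" for c :: "real^'d" and s by simp
  define v where "v = measure lebesgue (ball (0::real^'d) (r / 2))"
  have v: "emeasure lebesgue (ball c (r / 2)) = ennreal v" for c :: "real^'d"
  proof -
    have "ball c (r / 2) = (+) c ` ball 0 (r / 2)" by (simp add: ball_translation[symmetric])
    then show ?thesis
      unfolding v_def using measure_translation[of c "ball 0 (r / 2)"]
      by (metis emeasure_eq_measure2 lmeasurable_ball)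
  qed
  have v0: "v > 0" unfolding v_def using r by (simp add: content_ball_pos)
  show thesis
  \<comment> \<open>Each of the \<open>card J\<close> covering balls contributes
    \<open>1 / v\<close>, where \<open>v\<close> is the volume of one ball; the added 1 makes
    positivity immediate.\<close>
  proof (rule that[of "(real (card J) + 1) / v"])
    fix \<Phi> and f :: "real^'d \<Rightarrow> complex" assume f [measurable]: "f \<in> borel_measurable lebesgue"
    define N where "N = (\<lambda>x. orlicz_norm \<Phi> lebesgue (restrict_translate Q\<^sub>0 f x))"
    have Nm [measurable]: "N \<in> borel_measurable lebesgue"
      unfolding N_def by (rule restrict_translate_norm_measurable[OF Q(1) f])
    define b where "b = (\<lambda>p k. orlicz_norm \<Phi> lebesgue (\<lambda>y. f y * indicator (ball (p + k) (r / 2)) y))"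
    have bN: "ennreal v * b p k \<le> (\<integral>\<^sup>+x. N x * indicator (ball (p - q + k) (r / 2)) x \<partial>lebesgue)" for p k
    proof -
      have "b p k \<le> N x" if x: "x \<in> ball (p - q + k) (r / 2)" for x
      proof -
        have "y \<in> (\<lambda>q. q + x) ` Q\<^sub>0" if y: "y \<in> ball (p + k) (r / 2)" for y
        proof -
          have "dist q (y - x) = norm ((p - q + k - x) - (p + k - y))"
            by (simp add: dist_norm norm_minus_commute algebra_simps)
          also have "\<dots> \<le> norm (p - q + k - x) + norm (p + k - y)" by (rule norm_triangle_ineq4)
          also have "\<dots> < r" using x y by (simp add: dist_norm)
          finally have "y - x \<in> Q\<^sub>0" using r(3) by auto
          then show ?thesis by (intro image_eqI[of _ _ "y - x"]) auto
        qed
        then show ?thesis unfolding b_def N_def restrict_translate_def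
          by (intro orlicz_norm_mono_AE AE_I2) (auto simp: indicator_def norm_mult)
      qed
      then have "(\<integral>\<^sup>+x. b p k * indicator (ball (p - q + k) (r / 2)) x \<partial>lebesgue)
          \<le> (\<integral>\<^sup>+x. N x * indicator (ball (p - q + k) (r / 2)) x \<partial>lebesgue)"
        by (intro nn_integral_mono) (auto simp: indicator_def)
      then show ?thesis by (simp add: nn_integral_cmult_indicator v mult.commute)
    qed
    have sum_b: "ennreal v * (\<integral>\<^sup>+k. b p k \<partial>count_space int_lattice) \<le> wiener_amalgam_norm \<Phi> Q\<^sub>0 f" for p
    proof -
      have "ennreal v * (\<integral>\<^sup>+k. b p k \<partial>count_space int_lattice) = (\<integral>\<^sup>+k. ennreal v * b p k \<partial>count_space int_lattice)"
        by (rule nn_integral_cmult[symmetric]) simp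
      also have "\<dots> \<le> (\<integral>\<^sup>+k. (\<integral>\<^sup>+x. N x * indicator (ball (p - q + k) (r / 2)) x \<partial>lebesgue) \<partial>count_space int_lattice)"
        by (intro nn_integral_mono bN)
      also have "\<dots> = (\<integral>\<^sup>+x. (\<integral>\<^sup>+k. N x * indicator (ball (p - q + k) (r / 2)) x \<partial>count_space int_lattice) \<partial>lebesgue)"
        by (intro nn_integral_count_space_nn_integral[symmetric] countable_int_lattice) measurable
      also have "\<dots> \<le> (\<integral>\<^sup>+x. N x * 1 \<partial>lebesgue)"
      proof (rule nn_integral_mono)
        fix x
        have "(\<integral>\<^sup>+k. N x * indicator (ball (p - q + k) (r / 2)) x \<partial>count_space int_lattice)
            = N x * (\<integral>\<^sup>+k. indicator (ball (p - q + k) (r / 2)) x \<partial>count_space int_lattice)"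
          by (rule nn_integral_cmult) simp
        also have "\<dots> \<le> N x * 1" by (intro mult_left_mono lattice_balls_multiplicity r(2)) simp
        finally show "(\<integral>\<^sup>+k. N x * indicator (ball (p - q + k) (r / 2)) x \<partial>count_space int_lattice) \<le> N x * 1" .
      qed
      finally show ?thesis by (simp add: wiener_amalgam_norm_def N_def)
    qed
    have cover: "orlicz_norm \<Phi> lebesgue (\<lambda>y. f y * indicator (cbox (a + k) (a + k + One)) y) \<le> (\<Sum>p\<in>J. b p k)" for k
    proof -
      have "ennreal (cmod (f y * indicator (cbox (a + k) (a + k + One)) y))
          \<le> (\<integral>\<^sup>+p. ennreal (cmod (f y * indicator (ball (p + k) (r / 2)) y)) \<partial>count_space J)" for y
      proof (cases "y \<in> cbox (a + k) (a + k + One)")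
        case True
        then have "y - k \<in> cbox a (a + One)" by (auto simp: mem_box algebra_simps)
        then obtain p where p: "p \<in> J" "y - k \<in> ball p (r / 2)" using J(2) by blast
        then have "y \<in> ball (p + k) (r / 2)" by (simp add: dist_norm algebra_simps)
        then show ?thesis
          using True p(1) J(1) member_le_sum[of p J "\<lambda>p. ennreal (cmod (f y * indicator (ball (p + k) (r / 2)) y))"]
          by (simp add: nn_integral_count_space_finite)
      qed simp
      then have "orlicz_norm \<Phi> lebesgue (\<lambda>y. f y * indicator (cbox (a + k) (a + k + One)) y)
          \<le> orlicz_norm_nn \<Phi> lebesgue (\<lambda>y. \<integral>\<^sup>+p. ennreal (cmod (f y * indicator (ball (p + k) (r / 2)) y)) \<partial>count_space J)"
        unfolding orlicz_norm_eq_nn by (intro orlicz_norm_nn_mono_AE AE_I2)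
      also have "\<dots> \<le> (\<integral>\<^sup>+p. b p k \<partial>count_space J)"
        unfolding b_def orlicz_norm_eq_nn
        by (intro orlicz_norm_nn_countable_sum countable_finite J(1)) measurable
      finally show ?thesis using J(1) by (simp add: nn_integral_count_space_finite)
    qed
    let ?W = "wiener_amalgam_norm \<Phi> Q\<^sub>0 f"
    have "(\<integral>\<^sup>+k. orlicz_norm \<Phi> lebesgue (\<lambda>y. f y * indicator (cbox (a + k) (a + k + One)) y) \<partial>count_space int_lattice)
      \<le> (\<integral>\<^sup>+k. (\<Sum>p\<in>J. b p k) \<partial>count_space int_lattice)"
      by (intro nn_integral_mono cover)
    also have "\<dots> = (\<Sum>p\<in>J. \<integral>\<^sup>+k. b p k \<partial>count_space int_lattice)"
      by (rule nn_integral_sum) simp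
    also have "\<dots> \<le> (\<Sum>p\<in>J. ennreal (1 / v) * ?W)"
    proof (rule sum_mono)
      fix p
      have "(\<integral>\<^sup>+k. b p k \<partial>count_space int_lattice)
          = ennreal (1 / v) * (ennreal v * (\<integral>\<^sup>+k. b p k \<partial>count_space int_lattice))"
        using v0 by (simp add: mult.assoc[symmetric] flip: ennreal_mult)
      also have "\<dots> \<le> ennreal (1 / v) * ?W" by (intro mult_left_mono sum_b) simp
      finally show "(\<integral>\<^sup>+k. b p k \<partial>count_space int_lattice) \<le> ennreal (1 / v) * ?W" .
    qed
    also have "\<dots> = ennreal (real (card J) / v) * ?W"
      using v0 by (simp add: ennreal_of_nat_eq_real_of_nat mult.assoc[symmetric] flip: ennreal_mult)
    also have "\<dots> \<le> ennreal ((real (card J) + 1) / v) * ?W"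
      using v0 by (intro mult_right_mono ennreal_leI divide_right_mono) auto
    finally show "(\<integral>\<^sup>+k. orlicz_norm \<Phi> lebesgue (\<lambda>y. f y * indicator (cbox (a + k) (a + k + One)) y) \<partial>count_space int_lattice)
      \<le> ennreal ((real (card J) + 1) / v) * ?W" .
  qed (use v0 in auto)
qed

section \<open>The Zak transform\<close>

text \<open>The set is a cylinder over a translate of \<open>N\<close>; its product measure is 0
  times infinity, which is 0.\<close>

lemma null_sets_fst_shift:
  fixes N :: "'a::euclidean_space set"
  assumes "N \<in> null_sets lborel"
  shows "{z::'a \<times> 'b::euclidean_space. fst z + k \<in> N} \<in> null_sets lborel"
proof -
  define N' where "N' = {x. x + k \<in> N}"
  have N': "N' \<in> null_sets lborel" unfolding N'_def using null_sets_translation[OF assms, of "- k"] by simp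
  then have "emeasure (lborel \<Otimes>\<^sub>M lborel) (N' \<times> (UNIV :: 'b set)) = 0"
    by (subst lborel.emeasure_pair_measure_Times) (auto simp: null_sets_def)
  then have "N' \<times> (UNIV :: 'b set) \<in> null_sets (lborel \<Otimes>\<^sub>M lborel)"
    using N' by (intro null_setsI pair_measureI) auto
  moreover have "{z::'a \<times> 'b. fst z + k \<in> N} = N' \<times> UNIV" by (auto simp: N'_def)
  ultimately show ?thesis by (simp add: lborel_prod)
qed

lemma AE_fst_shift:
  fixes k :: "'a::euclidean_space"
  assumes "AE x in lborel. P x"
  shows "AE z in (lborel :: ('a \<times> 'b::euclidean_space) measure). P (fst z + k)"
proof -
  obtain N where N: "{x \<in> space lborel. \<not> P x} \<subseteq> N" "N \<in> null_sets lborel"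
    using assms by (auto elim!: AE_E simp: null_sets_def)
  show ?thesis by (rule AE_I'[OF null_sets_fst_shift[OF N(2), of k]]) (use N(1) in auto)
qed

text \<open>A Lebesgue measurable function composed with a continuous map can fail to be Lebesgue
  measurable; here preimages of null sets are null, so it is.\<close>

lemma measurable_fst_shift:
  fixes k :: "'a::euclidean_space"
  assumes "f \<in> borel_measurable lebesgue"
  shows "(\<lambda>z. f (fst z + k)) \<in> borel_measurable (lebesgue :: ('a \<times> 'b::euclidean_space) measure)"
proof -
  have *: "(\<lambda>z. fst z + k) \<in> (lebesgue :: ('a \<times> 'b) measure) \<rightarrow>\<^sub>M lborel"
    by (intro measurable_completion) (simp add: borel_measurable_continuous_onI continuous_intros)
  have "(\<lambda>z. fst z + k) \<in> (lebesgue :: ('a \<times> 'b) measure) \<rightarrow>\<^sub>M lebesgue"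
  proof (rule completion.measurable_completion2[OF *], safe)
    fix N :: "'a set" assume N: "N \<in> null_sets lborel"
    have "{z::'a \<times> 'b. fst z + k \<in> N} \<in> null_sets lebesgue"
      by (intro null_sets_completionI null_sets_fst_shift N)
    with N show "N \<in> null_sets (distr lebesgue lborel (\<lambda>z::'a \<times> 'b. fst z + k))"
      by (subst null_sets_distr_iff[OF *]) (auto simp: vimage_def dest: null_setsD2)
  qed
  from measurable_compose[OF this assms] show ?thesis .
qed

section \<open>Unit cubes and iterated integrals\<close>

lemma One_prod: "(One :: 'a::euclidean_space \<times> 'b::euclidean_space) = (One, One)"
proof (rule euclidean_eqI)
  fix i :: "'a \<times> 'b" assume i: "i \<in> Basis"
  then have "(One :: 'a \<times> 'b) \<bullet> i = 1" by (rule inner_sum_Basis)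
  moreover from i have "((One, One) :: 'a \<times> 'b) \<bullet> i = 1"
    by (auto simp: Basis_prod_def inner_sum_Basis)
  ultimately show "(One :: 'a \<times> 'b) \<bullet> i = ((One, One) :: 'a \<times> 'b) \<bullet> i" by simp
qed

lemma emeasure_unit_cube: "emeasure lborel (cbox b (b + One :: 'a::euclidean_space)) = 1"
  by (subst emeasure_lborel_cbox) (auto simp: inner_add_left inner_sum_Basis)

text \<open>The faces of the box form a null set, and by completeness any part of them is
  measurable.\<close>

lemma between_boxes_lmeasurable:
  fixes a b :: "'a::euclidean_space"
  assumes "box a b \<subseteq> Q" "Q \<subseteq> cbox a b"
  shows "Q \<in> lmeasurable" "AE z in lebesgue. z \<in> Q \<longleftrightarrow> z \<in> cbox a b"
proof -
  have null: "cbox a b - box a b \<in> null_sets lebesgue"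
    using negligible_frontier_interval[of a b] by (simp add: negligible_iff_null_sets)
  have "Q - box a b \<in> null_sets lebesgue"
    by (rule completion.complete2[OF _ null]) (use assms in auto)
  moreover have "Q = box a b \<union> (Q - box a b)" using assms by auto
  ultimately have "Q \<in> sets lebesgue"
    by (metis null_setsD2 sets.Un sets_completionI_sets lborelD borel_open open_box sets_lborel)
  then show "Q \<in> lmeasurable"
    by (intro fmeasurableI2[OF lmeasurable_cbox[of a b]] assms)
  show "AE z in lebesgue. z \<in> Q \<longleftrightarrow> z \<in> cbox a b"
    by (rule AE_I'[OF null]) (use assms in auto)
qed

text \<open>\<open>G\<close> is Borel because Tonelli is applied to the product of two
  \<open>lborel\<close> measures. The integral over \<open>w\<close> is innermost, so that later
  arguments can work at fixed \<open>t\<close>.\<close>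

lemma nn_integral_unit_cube_pair:
  fixes a :: "'a::euclidean_space" and b :: "'b::euclidean_space"
  assumes Q: "box (a, b) ((a, b) + One) \<subseteq> Q" "Q \<subseteq> cbox (a, b) ((a, b) + One)"
    and G [measurable]: "G \<in> borel_measurable borel"
  shows "(\<integral>\<^sup>+z. G z \<partial>lebesgue_on Q)
    = (\<integral>\<^sup>+t. (\<integral>\<^sup>+w. G (t, w) * indicator (cbox b (b + One)) w \<partial>lborel) * indicator (cbox a (a + One)) t \<partial>lborel)"
proof -
  note Q' = between_boxes_lmeasurable[OF Q]
  have "(\<integral>\<^sup>+z. G z \<partial>lebesgue_on Q) = (\<integral>\<^sup>+z. G z * indicator Q z \<partial>lebesgue)"
    using Q'(1) by (intro nn_integral_restrict_space) auto
  also have "\<dots> = (\<integral>\<^sup>+z. G z * indicator (cbox (a, b) ((a, b) + One)) z \<partial>lebesgue)"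
    by (rule nn_integral_cong_AE) (use Q'(2) in \<open>eventually_elim, simp add: indicator_def\<close>)
  also have "\<dots> = (\<integral>\<^sup>+z. G z * indicator (cbox (a, b) ((a, b) + One)) z \<partial>(lborel \<Otimes>\<^sub>M lborel))"
    by (simp add: nn_integral_completion lborel_prod)
  also have "\<dots> = (\<integral>\<^sup>+t. \<integral>\<^sup>+w. G (t, w) * indicator (cbox (a, b) ((a, b) + One)) (t, w) \<partial>lborel \<partial>lborel)"
    by (rule lborel.nn_integral_fst[symmetric]) (unfold lborel_prod, measurable)
  also have "\<dots> = (\<integral>\<^sup>+t. (\<integral>\<^sup>+w. G (t, w) * indicator (cbox b (b + One)) w \<partial>lborel) * indicator (cbox a (a + One)) t \<partial>lborel)"
    by (intro nn_integral_cong) (auto simp: One_prod cbox_Pair_eq indicator_def)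
  finally show ?thesis .
qed

text \<open>Provides the Borel functions to which Tonelli and the translation invariance of
  \<open>lborel\<close> are applied.\<close>

lemma borel_representative:
  fixes f :: "'a::euclidean_space \<Rightarrow> complex"
  assumes [measurable]: "f \<in> borel_measurable lebesgue"
  obtains g where "g \<in> borel_measurable borel" "AE x in lborel. f x = g x"
proof -
  have "(\<lambda>x. Re (f x)) \<in> borel_measurable lebesgue" "(\<lambda>x. Im (f x)) \<in> borel_measurable lebesgue"
    by measurable
  then obtain g h where gh: "g \<in> borel_measurable lborel" "AE x in lborel. Re (f x) = g x"
    "h \<in> borel_measurable lborel" "AE x in lborel. Im (f x) = h x"
    using completion_ex_borel_measurable_real by metis
  show thesis
  proof (rule that[of "\<lambda>x. Complex (g x) (h x)"])
    have [measurable]: "g \<in> borel_measurable borel" "h \<in> borel_measurable borel" using gh by auto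
    show "(\<lambda>x. Complex (g x) (h x)) \<in> borel_measurable borel"
      by (subst borel_measurable_complex_iff) simp
    show "AE x in lborel. f x = Complex (g x) (h x)"
      using gh(2,4) by eventually_elim (simp add: complex_eq_iff)
  qed
qed

section \<open>Terms of the Zak series\<close>

lemma zak_term_eq: "zak_term f k z = f (fst z + k) * exp (2 * of_real pi * \<i> * of_real (k \<bullet> snd z))"
  by (simp add: zak_term_def split_beta)

lemma zak_term_measurable:
  assumes "f \<in> borel_measurable lebesgue"
  shows "zak_term f k \<in> borel_measurable (lebesgue_on Q)"
proof -
  note [measurable] = measurable_fst_shift[OF assms, of k]
  have [measurable]: "(\<lambda>z. exp (2 * of_real pi * \<i> * of_real (k \<bullet> snd z))) \<in> borel_measurable (lebesgue :: ((real^'a) \<times> (real^'a)) measure)"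
    by (intro measurable_completion) (simp add: borel_measurable_continuous_onI continuous_intros)
  have "zak_term f k \<in> borel_measurable lebesgue"
    unfolding zak_term_eq[abs_def] by measurable
  then show ?thesis by (rule measurable_restrict_space1)
qed

lemma zak_term_borel:
  assumes "f \<in> borel_measurable borel"
  shows "zak_term f k \<in> borel_measurable borel"
  unfolding zak_term_eq[abs_def]
proof (rule borel_measurable_times)
  show "(\<lambda>z. f (fst z + k)) \<in> borel_measurable borel"
    by (rule measurable_compose[OF _ assms]) (intro borel_measurable_continuous_onI continuous_intros)
qed (intro borel_measurable_continuous_onI continuous_intros)

lemma zak_term_AE_cong:
  fixes f g :: "real^'d \<Rightarrow> complex"
  assumes "AE x in lborel. f x = g x" "Q \<in> sets lebesgue"
  shows "AE z in lebesgue_on Q. zak_term f k z = zak_term g k z"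
proof -
  have "AE z in (lborel :: ((real^'d) \<times> (real^'d)) measure). f (fst z + k) = g (fst z + k)"
    by (rule AE_fst_shift[OF assms(1)])
  then have "AE z in (lebesgue :: ((real^'d) \<times> (real^'d)) measure). f (fst z + k) = g (fst z + k)" by (rule AE_completion)
  then have "AE z in lebesgue. zak_term f k z = zak_term g k z"
    by eventually_elim (simp add: zak_term_eq)
  then show ?thesis
    using assms(2) by (subst AE_restrict_space_iff) (auto elim: eventually_mono)
qed

lemma cmod_zak_term: "cmod (zak_term f k z) = cmod (f (fst z + k))"
proof -
  have "cmod (exp (2 * of_real pi * \<i> * of_real (k \<bullet> snd z))) = 1"
    by (simp add: norm_exp_eq_Re)
  then show ?thesis by (simp add: zak_term_eq norm_mult)
qed

lemma zak_term_norm_le: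
  fixes f :: "real^'d \<Rightarrow> complex" and a b :: "real^'d"
  assumes Y: "young_function \<Phi>" and f: "f \<in> borel_measurable lebesgue"
    and Q: "box (a, b) ((a, b) + One) \<subseteq> Q" "Q \<subseteq> cbox (a, b) ((a, b) + One)"
  shows "orlicz_norm \<Phi> (lebesgue_on Q) (zak_term f k)
    \<le> 2 * orlicz_norm \<Phi> lebesgue (\<lambda>y. f y * indicator (cbox (a + k) (a + k + One)) y)"
    (is "?L \<le> 2 * ?N")
proof -
  interpret sigma_finite_measure "lebesgue :: (real^'d) measure" by (rule sigma_finite_lebesgue)
  note Q' = between_boxes_lmeasurable[OF Q]
  obtain g where g [measurable]: "g \<in> borel_measurable borel" and fg: "AE x in lborel. f x = g x"
    by (rule borel_representative[OF f]) (rule that)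
  let ?c = "cbox (a + k) (a + k + One)"
  \<comment> \<open>Every \<open>c\<close> strictly above the norm is treated, as the passage to the
    modular demands; the \<open>e / 2\<close> at the end lets \<open>c\<close> decrease to
    it.\<close>
  have bound: "?L \<le> ennreal (2 * c)" if c: "?N < ennreal c" for c
  proof -
    have c0: "c > 0" using c by (cases "c > 0") (auto simp: ennreal_neg)
    have \<Phi>m: "(\<lambda>x. \<Phi> (cmod (g x) / c)) \<in> borel_measurable borel"
      by (rule young_measurable[OF Y]) (use c0 in auto)
    have "(\<integral>\<^sup>+z. \<Phi> (cmod (zak_term f k z) / c) \<partial>lebesgue_on Q)
        = (\<integral>\<^sup>+z. \<Phi> (cmod (g (fst z + k)) / c) \<partial>lebesgue_on Q)"
    proof (rule nn_integral_cong_AE)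
      show "AE z in lebesgue_on Q. \<Phi> (cmod (zak_term f k z) / c) = \<Phi> (cmod (g (fst z + k)) / c)"
        using zak_term_AE_cong[OF fg fmeasurableD[OF Q'(1)], of k]
        by eventually_elim (simp add: cmod_zak_term)
    qed
    also have "\<dots> = (\<integral>\<^sup>+t. (\<integral>\<^sup>+w. \<Phi> (cmod (g (t + k)) / c) * indicator (cbox b (b + One)) w \<partial>lborel)
        * indicator (cbox a (a + One)) t \<partial>lborel)"
    proof (subst nn_integral_unit_cube_pair[OF Q])
      have "(\<lambda>z::(real^'d) \<times> (real^'d). fst z + k) \<in> borel_measurable borel"
        by (intro borel_measurable_continuous_onI continuous_intros)
      from measurable_compose[OF this \<Phi>m]
      show "(\<lambda>z::(real^'d) \<times> (real^'d). \<Phi> (cmod (g (fst z + k)) / c)) \<in> borel_measurable borel" .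
    qed simp
    \<comment> \<open>The integrand does not depend on \<open>w\<close>, and the
      \<open>w\<close>-cube has volume 1.\<close>
    also have "\<dots> = (\<integral>\<^sup>+t. \<Phi> (cmod (g (t + k)) / c) * indicator (cbox a (a + One)) t \<partial>lborel)"
      by (simp add: nn_integral_cmult_indicator emeasure_unit_cube)
    also have "\<dots> = (\<integral>\<^sup>+t. \<Phi> (cmod (g (k + t)) / c) * indicator ?c (k + t) \<partial>lborel)"
      by (intro nn_integral_cong) (auto simp: indicator_def mem_box algebra_simps)
    also have "\<dots> = (\<integral>\<^sup>+y. \<Phi> (cmod (g y) / c) * indicator ?c y \<partial>distr lborel borel ((+) k))"
      using \<Phi>m by (subst nn_integral_distr) simp_all
    also have "\<dots> = (\<integral>\<^sup>+y. \<Phi> (cmod (g y) / c) * indicator ?c y \<partial>lborel)"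
      by (simp only: lborel_distr_plus)
    \<comment> \<open>The indicator may move inside because \<open>\<Phi> 0 = 0\<close>.\<close>
    also have "\<dots> = (\<integral>\<^sup>+y. \<Phi> (cmod (f y * indicator ?c y) / c) \<partial>lborel)"
    proof (rule nn_integral_cong_AE)
      show "AE y in lborel. \<Phi> (cmod (g y) / c) * indicator ?c y = \<Phi> (cmod (f y * indicator ?c y) / c)"
        using fg by eventually_elim (simp add: young_zero[OF Y] split: split_indicator)
    qed
    also have "\<dots> = (\<integral>\<^sup>+y. \<Phi> (cmod (f y * indicator ?c y) / c) \<partial>lebesgue)"
      by (simp add: nn_integral_completion)
    also have "\<dots> \<le> 1"
      by (intro modular_scaled_le_one[OF Y _ c] borel_measurable_times f borel_measurable_indicator) simp
    finally have mod1: "(\<integral>\<^sup>+z. \<Phi> (cmod (zak_term f k z) / c) \<partial>lebesgue_on Q) \<le> 1" .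
    note um = zak_term_measurable[OF f, of k Q]
    have "?L = orlicz_norm \<Phi> (lebesgue_on Q) (\<lambda>z. of_real c * (of_real (1 / c) * zak_term f k z))"
      using c0 by (simp add: mult.assoc[symmetric] flip: of_real_mult)
    also have "\<dots> = ennreal c * orlicz_norm \<Phi> (lebesgue_on Q) (\<lambda>z. of_real (1 / c) * zak_term f k z)"
      using c0 um by (subst orlicz_norm_cmult) simp_all
    also have "\<dots> \<le> ennreal c * ((\<integral>\<^sup>+z. \<Phi> (cmod (of_real (1 / c) * zak_term f k z)) \<partial>lebesgue_on Q) + 1)"
      using um by (intro mult_left_mono orlicz_norm_le_modular[OF Y]) simp_all
    also have "\<dots> \<le> ennreal c * (1 + 1)"
      using mod1 c0 by (intro mult_left_mono add_mono order_refl) (simp_all add: norm_mult norm_divide)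
    also have "\<dots> = ennreal (2 * c)" using c0 by (simp add: ennreal_mult mult.commute)
    finally show ?thesis .
  qed
  show ?thesis
  proof (cases ?N rule: ennreal_cases)
    case (real n)
    show ?thesis
    proof (rule ennreal_le_epsilon)
      fix e :: real assume e: "0 < e"
      have "?L \<le> ennreal (2 * (n + e / 2))"
        using real e by (intro bound) (simp add: ennreal_less_iff)
      also have "\<dots> = 2 * ?N + ennreal e"
        using real e by (simp add: ennreal_plus ennreal_mult algebra_simps)
      finally show "?L \<le> 2 * ?N + ennreal e" .
    qed
  qed (simp add: ennreal_mult_top)
qed


section \<open>Orthogonality of characters and injectivity\<close>

lemma integral_exp_unit_interval:
  fixes m \<beta> :: real
  assumes "m \<in> \<int>"
  defines "h \<equiv> \<lambda>s. indicator {\<beta>..\<beta> + 1} s *\<^sub>R exp (2 * of_real pi * \<i> * of_real (m * s))"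
  shows "has_bochner_integral lborel h (if m = 0 then 1 else 0)"
proof (cases "m = 0")
  case True
  have "has_bochner_integral lborel (\<lambda>s. indicator {\<beta>..\<beta> + 1} s *\<^sub>R (1::complex)) (of_real (\<beta> + 1) - of_real \<beta>)"
    by (rule has_bochner_integral_FTC_Icc[where F = "\<lambda>s. of_real s"])
      (auto intro!: derivative_eq_intros simp: has_vector_derivative_def has_derivative_of_real bounded_linear_of_real fun_eq_iff scaleR_conv_of_real)
  then show ?thesis using True by (simp add: h_def)
next
  case False
  obtain n :: int where n: "m = of_int n" using assms(1) by (auto elim: Ints_cases)
  define \<mu> where "\<mu> = 2 * of_real pi * \<i> * complex_of_real m"
  have \<mu>: "\<mu> \<noteq> 0" using False by (simp add: \<mu>_def)
  have "has_bochner_integral lborel (\<lambda>s. indicator {\<beta>..\<beta> + 1} s *\<^sub>R exp (\<mu> * of_real s))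
      (exp (\<mu> * of_real (\<beta> + 1)) / \<mu> - exp (\<mu> * of_real \<beta>) / \<mu>)"
  proof (rule has_bochner_integral_FTC_Icc)
    fix s :: real
    have "((\<lambda>z. exp (\<mu> * z) / \<mu>) has_field_derivative exp (\<mu> * of_real s)) (at (of_real s))"
      using \<mu> by (auto intro!: derivative_eq_intros)
    from has_vector_derivative_real_field[OF this]
    show "((\<lambda>s. exp (\<mu> * of_real s) / \<mu>) has_vector_derivative exp (\<mu> * of_real s))
        (at s within {\<beta>..\<beta> + 1})" by (simp add: o_def)
  qed (auto intro!: continuous_intros)
  \<comment> \<open>For an integer frequency the antiderivative has period 1, so its boundary values
    cancel.\<close>
  moreover have "exp (\<mu> * of_real (\<beta> + 1)) = exp (\<mu> * of_real \<beta>)"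
  proof -
    have "exp \<mu> = 1" unfolding \<mu>_def n by (simp add: exp_eq_1 ac_simps)
    then show ?thesis by (simp add: distrib_left exp_add)
  qed
  ultimately show ?thesis using False by (simp add: h_def \<mu>_def ac_simps)
qed

text \<open>Character and indicator both factor over the coordinates; a nonzero lattice vector has a
  nonzero coordinate, whose factor integrates to 0.\<close>

lemma integral_exp_unit_cube:
  fixes m b :: "real^'d"
  assumes "m \<in> int_lattice"
  defines "h \<equiv> \<lambda>w. exp (2 * of_real pi * \<i> * of_real (m \<bullet> w)) * indicator (cbox b (b + One)) w"
  shows "integrable lborel h" "(\<integral>w. h w \<partial>lborel) = (if m = 0 then 1 else 0)"
proof -
  let ?e = "\<lambda>w. exp (2 * of_real pi * \<i> * of_real (m \<bullet> w)) :: complex"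
  have "integrable lborel (\<lambda>w. indicator (cbox b (b + One)) w *\<^sub>R ?e w)"
    by (intro borel_integrable_compact compact_cbox continuous_intros)
  moreover have heq: "h = (\<lambda>w. indicator (cbox b (b + One)) w *\<^sub>R ?e w)"
    by (auto simp: h_def indicator_def fun_eq_iff)
  ultimately show int: "integrable lborel h" by simp
  interpret P: product_sigma_finite "\<lambda>_::real^'d. lborel :: real measure" ..
  define p where "p = (\<lambda>(i::real^'d) s. indicator {b \<bullet> i..b \<bullet> i + 1} s *\<^sub>R
      exp (2 * of_real pi * \<i> * of_real ((m \<bullet> i) * s)) :: complex)"
  have mi: "m \<bullet> i \<in> \<int>" if "i \<in> Basis" for i
    using assms(1) that by (auto simp: int_lattice_def Basis_vec_def inner_axis)
  have p: "has_bochner_integral lborel (p i) (if m \<bullet> i = 0 then 1 else 0)" if "i \<in> Basis" for i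
    unfolding p_def by (rule integral_exp_unit_interval[OF mi[OF that]])
  have hp: "h w = (\<Prod>i\<in>Basis. p i (w \<bullet> i))" for w
  proof -
    have "(\<Prod>i\<in>Basis. p i (w \<bullet> i)) = (\<Prod>i\<in>Basis. of_real (indicator {b \<bullet> i..b \<bullet> i + 1} (w \<bullet> i))) *
        (\<Prod>i\<in>Basis. exp (2 * of_real pi * \<i> * of_real ((m \<bullet> i) * (w \<bullet> i))))"
      by (simp add: p_def scaleR_conv_of_real prod.distrib)
    also have "(\<Prod>i\<in>Basis. exp (2 * of_real pi * \<i> * of_real ((m \<bullet> i) * (w \<bullet> i)))) = ?e w"
      unfolding euclidean_inner[of m w] by (simp add: exp_sum sum_distrib_left)
    also have "(\<Prod>i\<in>Basis. of_real (indicator {b \<bullet> i..b \<bullet> i + 1} (w \<bullet> i)) :: complex)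
        = indicator (cbox b (b + One)) w"
    proof (cases "w \<in> cbox b (b + One)")
      case True
      then show ?thesis by (auto simp: mem_box inner_add_left inner_sum_Basis intro!: prod.neutral)
    next
      case False
      then obtain i where "i \<in> Basis" "w \<bullet> i \<notin> {b \<bullet> i..b \<bullet> i + 1}"
        by (auto simp: mem_box inner_add_left inner_sum_Basis)
      then show ?thesis using False by (auto intro!: prod_zero bexI[of _ i])
    qed
    finally show ?thesis by (simp add: h_def mult.commute)
  qed
  have "(\<integral>w. h w \<partial>lborel) = (\<integral>x. h (\<Sum>i\<in>Basis. x i *\<^sub>R i) \<partial>(\<Pi>\<^sub>M i\<in>Basis. lborel))"
    by (subst lborel_eq, subst integral_distr) (use int in auto)
  also have "\<dots> = (\<integral>x. (\<Prod>i\<in>Basis. p i (x i)) \<partial>(\<Pi>\<^sub>M i\<in>Basis. lborel))"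
    by (intro Bochner_Integration.integral_cong refl) (simp add: hp)
  also have "\<dots> = (\<Prod>i\<in>Basis. integral\<^sup>L lborel (p i))"
    by (rule P.product_integral_prod) (use p in \<open>auto simp: has_bochner_integral_iff\<close>)
  also have "\<dots> = (\<Prod>i\<in>Basis. if m \<bullet> i = 0 then 1 else 0)"
    using p by (intro prod.cong) (auto simp: has_bochner_integral_iff)
  also have "\<dots> = (if m = 0 then 1 else 0)"
  proof (cases "m = 0")
    case False
    then obtain i where "i \<in> Basis" "m \<bullet> i \<noteq> 0" using euclidean_all_zero_iff[of m] by blast
    then show ?thesis using False by (auto intro!: prod_zero bexI[of _ i])
  qed simp
  finally show "(\<integral>w. h w \<partial>lborel) = (if m = 0 then 1 else 0)" .
qed

text \<open>\<open>c j\<close> is the \<open>j\<close>-th Fourier coefficient of the trigonometric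
  polynomial, and multiplying by the character with frequency \<open>- j\<close> does not change the
  modulus.\<close>

lemma coefficient_le_integral:
  fixes c :: "real^'d \<Rightarrow> complex" and b :: "real^'d"
  assumes K: "finite K" "K \<subseteq> int_lattice" "j \<in> K"
  shows "ennreal (cmod (c j)) \<le> (\<integral>\<^sup>+w. ennreal (cmod (\<Sum>k\<in>K. c k * exp (2 * of_real pi * \<i> * of_real (k \<bullet> w))))
    * indicator (cbox b (b + One)) w \<partial>lborel)"
proof -
  let ?e = "\<lambda>k w. exp (2 * of_real pi * \<i> * of_real (k \<bullet> w)) :: complex"
  define h where "h = (\<lambda>k w. ?e (k - j) w * indicator (cbox b (b + One)) w)"
  have mem: "k - j \<in> int_lattice" if "k \<in> K" for k using K that by (auto simp: int_lattice_def subset_eq intro!: Ints_diff)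
  have int: "integrable lborel (h k)" "(\<integral>w. h k w \<partial>lborel) = (if k = j then 1 else 0)" if "k \<in> K" for k
    using integral_exp_unit_cube[OF mem[OF that], of b] by (simp_all add: h_def)
  have "(\<integral>w. (\<Sum>k\<in>K. c k * h k w) \<partial>lborel) = (\<Sum>k\<in>K. c k * (\<integral>w. h k w \<partial>lborel))"
    using int(1) by (subst Bochner_Integration.integral_sum) auto
  also have "\<dots> = (\<Sum>k\<in>K. if k = j then c k else 0)"
    by (intro sum.cong) (auto simp: int(2))
  also have "\<dots> = c j" using K by simp
  finally have "ennreal (cmod (c j)) = ennreal (cmod (\<integral>w. (\<Sum>k\<in>K. c k * h k w) \<partial>lborel))" by simp
  also have "\<dots> \<le> (\<integral>\<^sup>+w. ennreal (cmod (\<Sum>k\<in>K. c k * h k w)) \<partial>lborel)"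
    using int(1) by (intro integral_norm_bound_ennreal) auto
  also have "\<dots> = (\<integral>\<^sup>+w. ennreal (cmod (\<Sum>k\<in>K. c k * ?e k w)) * indicator (cbox b (b + One)) w \<partial>lborel)"
  proof (rule nn_integral_cong)
    fix w
    have "(\<Sum>k\<in>K. c k * h k w) = ?e (- j) w * indicator (cbox b (b + One)) w * (\<Sum>k\<in>K. c k * ?e k w)"
      by (simp add: h_def sum_distrib_left inner_diff_left ring_distribs exp_diff exp_minus field_simps)
    then show "ennreal (cmod (\<Sum>k\<in>K. c k * h k w)) = ennreal (cmod (\<Sum>k\<in>K. c k * ?e k w)) * indicator (cbox b (b + One)) w"
      by (simp add: norm_mult norm_exp_eq_Re split: split_indicator)
  qed
  finally show ?thesis .
qed

lemma zak_zero_imp_zero: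
  fixes f :: "real^'d \<Rightarrow> complex" and a b :: "real^'d"
  assumes Y: "young_function \<Phi>" and f: "f \<in> borel_measurable lebesgue"
    and Q: "box (a, b) ((a, b) + One) \<subseteq> Q" "Q \<subseteq> cbox (a, b) ((a, b) + One)"
    and F: "has_orlicz_sum \<Phi> (lebesgue_on Q) (zak_term f) int_lattice F"
    and F0: "AE z in lebesgue_on Q. F z = 0"
  shows "AE x in lebesgue. f x = 0"
proof -
  note Q' = between_boxes_lmeasurable[OF Q]
  interpret finite_measure "lebesgue_on Q" by (rule finite_measure_lebesgue_on[OF Q'(1)])
  obtain C :: real where C: "0 < C" "\<And>h. h \<in> borel_measurable (lebesgue_on Q) \<Longrightarrow>
      (\<integral>\<^sup>+x. h x \<partial>lebesgue_on Q) \<le> ennreal C * orlicz_norm_nn \<Phi> (lebesgue_on Q) h"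
    by (rule integral_le_orlicz_norm[OF Y]) (rule that)
  obtain g where g [measurable]: "g \<in> borel_measurable borel" and fg: "AE x in lborel. f x = g x"
    by (rule borel_representative[OF f]) (rule that)
  have zero: "(\<integral>\<^sup>+t. ennreal (cmod (g (t + j))) * indicator (cbox a (a + One)) t \<partial>lborel) = 0"
    if j: "j \<in> int_lattice" for j
  proof -
    let ?I = "\<integral>\<^sup>+t. ennreal (cmod (g (t + j))) * indicator (cbox a (a + One)) t \<partial>lborel"
    let ?n = "\<lambda>K. orlicz_norm \<Phi> (lebesgue_on Q) (\<lambda>z. (\<Sum>k\<in>K. zak_term f k z) - F z)"
    \<comment> \<open>The left side is the same for every \<open>K\<close> containing
      \<open>j\<close>: at fixed \<open>t\<close>, the other terms do not affect the
      \<open>j\<close>-th coefficient \<open>g (t + j)\<close>.\<close>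
    have le: "?I \<le> ennreal C * ?n K" if K: "finite K" "{j} \<subseteq> K" "K \<subseteq> int_lattice" for K
    proof -
      have "?I \<le> (\<integral>\<^sup>+t. (\<integral>\<^sup>+w. ennreal (cmod (\<Sum>k\<in>K. zak_term g k (t, w))) * indicator (cbox b (b + One)) w \<partial>lborel)
          * indicator (cbox a (a + One)) t \<partial>lborel)"
        unfolding zak_term_def prod.case
        using K by (intro nn_integral_mono mult_right_mono coefficient_le_integral) auto
      also have "\<dots> = (\<integral>\<^sup>+z. ennreal (cmod (\<Sum>k\<in>K. zak_term g k z)) \<partial>lebesgue_on Q)"
      proof (rule nn_integral_unit_cube_pair[OF Q, symmetric])
        have "(\<lambda>z. \<Sum>k\<in>K. zak_term g k z) \<in> borel_measurable borel"
          by (intro borel_measurable_sum zak_term_borel g)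
        then show "(\<lambda>z. ennreal (cmod (\<Sum>k\<in>K. zak_term g k z))) \<in> borel_measurable borel" by simp
      qed
      also have "\<dots> = (\<integral>\<^sup>+z. ennreal (cmod ((\<Sum>k\<in>K. zak_term f k z) - F z)) \<partial>lebesgue_on Q)"
      proof (rule nn_integral_cong_AE)
        have "AE z in lebesgue_on Q. \<forall>k\<in>K. zak_term f k z = zak_term g k z"
          using K(1) zak_term_AE_cong[OF fg fmeasurableD[OF Q'(1)]]
          by (intro AE_ball_countable[THEN iffD2]) (auto simp: countable_finite)
        with F0 show "AE z in lebesgue_on Q. ennreal (cmod (\<Sum>k\<in>K. zak_term g k z))
            = ennreal (cmod ((\<Sum>k\<in>K. zak_term f k z) - F z))"
          by eventually_elim simp
      qed
      also have "\<dots> \<le> ennreal C * ?n K"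
      proof -
        have "F \<in> borel_measurable (lebesgue_on Q)"
          using F by (auto simp: has_orlicz_sum_def orlicz_space_def)
        then have "(\<lambda>z. (\<Sum>k\<in>K. zak_term f k z) - F z) \<in> borel_measurable (lebesgue_on Q)"
          by (intro borel_measurable_diff borel_measurable_sum zak_term_measurable f)
        then show ?thesis unfolding orlicz_norm_eq_nn by (intro C(2)) simp
      qed
      finally show ?thesis .
    qed
    have "((\<lambda>K. ennreal C * ?n K) \<longlongrightarrow> ennreal C * 0) (finite_subsets_at_top int_lattice)"
      using F by (intro ennreal_tendsto_cmult) (auto simp: has_orlicz_sum_def)
    moreover have "eventually (\<lambda>K. ?I \<le> ennreal C * ?n K) (finite_subsets_at_top int_lattice)"
      unfolding eventually_finite_subsets_at_top using le j by (intro exI[of _ "{j}"]) auto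
    ultimately have "?I \<le> ennreal C * 0" by (rule tendsto_lowerbound) simp
    then show ?thesis by simp
  qed
  have shift: "AE y in lborel. y - j \<in> cbox a (a + One) \<longrightarrow> g y = 0" if j: "j \<in> int_lattice" for j
  proof -
    have "(\<integral>\<^sup>+y. ennreal (cmod (g y)) * indicator (cbox a (a + One)) (y - j) \<partial>lborel)
        = (\<integral>\<^sup>+y. ennreal (cmod (g y)) * indicator (cbox a (a + One)) (y - j) \<partial>distr lborel borel ((+) j))"
      by (simp only: lborel_distr_plus)
    also have "\<dots> = (\<integral>\<^sup>+t. ennreal (cmod (g (j + t))) * indicator (cbox a (a + One)) (j + t - j) \<partial>lborel)"
      by (rule nn_integral_distr) measurable
    also have "\<dots> = 0" using zero[OF j] by (simp add: add.commute)
    finally have "AE y in lborel. ennreal (cmod (g y)) * indicator (cbox a (a + One)) (y - j) = 0"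
      by (subst (asm) nn_integral_0_iff_AE) measurable
    then show ?thesis by eventually_elim (auto simp: indicator_def split: if_splits)
  qed
  have "AE y in lborel. \<forall>j\<in>int_lattice. y - j \<in> cbox a (a + One) \<longrightarrow> g y = 0"
    using shift by (subst AE_ball_countable[OF countable_int_lattice]) auto
  then have "AE y in lborel. f y = 0"
    using fg
  proof eventually_elim
    fix y assume *: "\<forall>j\<in>int_lattice. y - j \<in> cbox a (a + One) \<longrightarrow> g y = 0" and "f y = g y"
    \<comment> \<open>The integer parts of the coordinates of \<open>y - a\<close> select a lattice
      translate of the cube that contains \<open>y\<close>.\<close>
    define j where "j = (\<chi> i. of_int \<lfloor>y $ i - a $ i\<rfloor> :: real^'d)"
    have "j \<in> int_lattice" by (simp add: j_def int_lattice_def)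
    moreover have "y - j \<in> cbox a (a + One)"
    proof -
      have "a $ i \<le> y $ i - j $ i \<and> y $ i - j $ i \<le> a $ i + 1" for i
        unfolding j_def by simp linarith
      moreover have "(One :: real^'d) $ i = 1" for i
        using inner_sum_Basis[of "axis i 1 :: real^'d"] by (simp add: inner_axis axis_in_Basis_iff)
      ultimately show ?thesis by (simp add: mem_box_cart)
    qed
    ultimately show "f y = 0" using * \<open>f y = g y\<close> by auto
  qed
  then show ?thesis by (rule AE_completion)
qed

section \<open>The Zak transform as a bounded injective operator\<close>

lemma zak_series_summable:
  fixes \<Phi> :: "real \<Rightarrow> ennreal"
    and Q\<^sub>0 :: "(real ^ 'd) set" and Q :: "((real ^ 'd) \<times> (real ^ 'd)) set"
  assumes Y: "young_function \<Phi>" and Q0: "compact Q\<^sub>0" "interior Q\<^sub>0 \<noteq> {}"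
    and Q: "box (a, b) ((a, b) + One) \<subseteq> Q" "Q \<subseteq> cbox (a, b) ((a, b) + One)"
  obtains C :: real where "0 < C"
    "\<And>f. f \<in> wiener_amalgam \<Phi> Q\<^sub>0 \<Longrightarrow>
      has_orlicz_sum \<Phi> (lebesgue_on Q) (zak_term f) int_lattice (zak_transform \<Phi> Q f)"
    "\<And>f. f \<in> wiener_amalgam \<Phi> Q\<^sub>0 \<Longrightarrow>
      orlicz_norm \<Phi> (lebesgue_on Q) (zak_transform \<Phi> Q f) \<le> ennreal C * wiener_amalgam_norm \<Phi> Q\<^sub>0 f"
proof -
  note Q' = between_boxes_lmeasurable[OF Q]
  interpret finite_measure "lebesgue_on Q" by (rule finite_measure_lebesgue_on[OF Q'(1)])
  let ?M = "lebesgue_on Q"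
  let ?W = "wiener_amalgam_norm \<Phi> Q\<^sub>0"
  obtain C :: real where C: "0 < C" "\<And>\<Phi> f. f \<in> borel_measurable lebesgue \<Longrightarrow>
    (\<integral>\<^sup>+k. orlicz_norm \<Phi> lebesgue (\<lambda>y. f y * indicator (cbox (a + k) (a + k + One)) y) \<partial>count_space int_lattice)
      \<le> ennreal C * wiener_amalgam_norm \<Phi> Q\<^sub>0 f"
    by (rule discrete_norm_le_wiener_amalgam_norm[OF Q0]) (rule that)
  \<comment> \<open>The 2 is the loss for a single term; \<open>C\<close> compares the discrete with
    the continuous amalgam norm.\<close>
  have *: "\<exists>F. has_orlicz_sum \<Phi> ?M (zak_term f) int_lattice F \<and> orlicz_norm \<Phi> ?M F \<le> ennreal (2 * C) * ?W f"
    if f: "f \<in> wiener_amalgam \<Phi> Q\<^sub>0" for f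
  proof -
    have fm: "f \<in> borel_measurable lebesgue" and fW: "?W f < \<infinity>"
      using f by (auto simp: wiener_amalgam_def wiener_amalgam_norm_def)
    have "(\<integral>\<^sup>+k. orlicz_norm \<Phi> ?M (zak_term f k) \<partial>count_space int_lattice)
        \<le> (\<integral>\<^sup>+k. 2 * orlicz_norm \<Phi> lebesgue (\<lambda>y. f y * indicator (cbox (a + k) (a + k + One)) y) \<partial>count_space int_lattice)"
      by (intro nn_integral_mono zak_term_norm_le[OF Y fm Q])
    also have "\<dots> = 2 * (\<integral>\<^sup>+k. orlicz_norm \<Phi> lebesgue (\<lambda>y. f y * indicator (cbox (a + k) (a + k + One)) y) \<partial>count_space int_lattice)"
      by (rule nn_integral_cmult) simp
    also have "\<dots> \<le> 2 * (ennreal C * ?W f)" by (intro mult_left_mono C(2)[OF fm]) simp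
    also have "\<dots> = ennreal (2 * C) * ?W f" using C(1) by (simp add: ennreal_mult mult.assoc)
    finally have le: "(\<integral>\<^sup>+k. orlicz_norm \<Phi> ?M (zak_term f k) \<partial>count_space int_lattice) \<le> ennreal (2 * C) * ?W f" .
    also have "\<dots> < \<infinity>" using fW by (simp add: ennreal_mult_less_top)
    finally have fin: "(\<integral>\<^sup>+k. orlicz_norm \<Phi> ?M (zak_term f k) \<partial>count_space int_lattice) < \<infinity>" .
    obtain F where "has_orlicz_sum \<Phi> ?M (zak_term f) int_lattice F"
      "orlicz_norm \<Phi> ?M F \<le> (\<integral>\<^sup>+k. orlicz_norm \<Phi> ?M (zak_term f k) \<partial>count_space int_lattice)"
      using absolutely_summable_has_orlicz_sum[OF Y countable_int_lattice zak_term_measurable[OF fm] fin] by blast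
    then show ?thesis using le by (auto intro: order_trans)
  qed
  have sum: "has_orlicz_sum \<Phi> ?M (zak_term f) int_lattice (zak_transform \<Phi> Q f)"
    if "f \<in> wiener_amalgam \<Phi> Q\<^sub>0" for f
    unfolding zak_transform_def by (rule someI_ex[of "has_orlicz_sum \<Phi> ?M (zak_term f) int_lattice"]) (use *[OF that] in blast)
  have "orlicz_norm \<Phi> ?M (zak_transform \<Phi> Q f) \<le> ennreal (2 * C) * ?W f"
    if f: "f \<in> wiener_amalgam \<Phi> Q\<^sub>0" for f
  proof -
    obtain F where F: "has_orlicz_sum \<Phi> ?M (zak_term f) int_lattice F"
      "orlicz_norm \<Phi> ?M F \<le> ennreal (2 * C) * ?W f" using *[OF f] by blast
    \<comment> \<open>The choice in \<open>zak_transform\<close> guarantees only a sum, not this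
      bound; uniqueness carries the bound over from \<open>F\<close>.\<close>
    from orlicz_norm_cong_AE[OF has_orlicz_sum_unique[OF Y sum[OF f] F(1)]] F(2) show ?thesis by simp
  qed
  with C(1) sum show thesis by (intro that[of "2 * C"]) auto
qed

theorem proposition5p3:
  fixes \<Phi> :: "real \<Rightarrow> ennreal"
    and Q\<^sub>0 :: "(real ^ 'd) set"
    and Q :: "((real ^ 'd) \<times> (real ^ 'd)) set"
  assumes "young_function \<Phi>"
    and "compact Q\<^sub>0" and "interior Q\<^sub>0 \<noteq> {}"
    and "unit_cube Q"
  shows
    \<comment> \<open>the series converges in the Orlicz space over \<open>Q\<close>, and its sum is unique\<close>
    "(\<forall>f \<in> wiener_amalgam \<Phi> Q\<^sub>0.
        has_orlicz_sum \<Phi> (lebesgue_on Q) (zak_term f) int_lattice (zak_transform \<Phi> Q f) \<and>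
        (\<forall>F. has_orlicz_sum \<Phi> (lebesgue_on Q) (zak_term f) int_lattice F \<longrightarrow>
             (AE z in lebesgue_on Q. F z = zak_transform \<Phi> Q f z))) \<and>
     \<comment> \<open>it maps into the Orlicz space and respects equality almost everywhere\<close>
     (\<forall>f \<in> wiener_amalgam \<Phi> Q\<^sub>0. zak_transform \<Phi> Q f \<in> orlicz_space \<Phi> (lebesgue_on Q)) \<and>
     (\<forall>f \<in> wiener_amalgam \<Phi> Q\<^sub>0. \<forall>g \<in> wiener_amalgam \<Phi> Q\<^sub>0.
        (AE x in lebesgue. f x = g x) \<longrightarrow>
        (AE z in lebesgue_on Q. zak_transform \<Phi> Q f z = zak_transform \<Phi> Q g z)) \<and>
     \<comment> \<open>linearity\<close>
     (\<forall>f \<in> wiener_amalgam \<Phi> Q\<^sub>0. \<forall>g \<in> wiener_amalgam \<Phi> Q\<^sub>0. \<forall>a b :: complex.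
        (\<lambda>x. a * f x + b * g x) \<in> wiener_amalgam \<Phi> Q\<^sub>0 \<and>
        (AE z in lebesgue_on Q. zak_transform \<Phi> Q (\<lambda>x. a * f x + b * g x) z =
           a * zak_transform \<Phi> Q f z + b * zak_transform \<Phi> Q g z)) \<and>
     \<comment> \<open>continuity with respect to the two norms\<close>
     (\<forall>f \<in> wiener_amalgam \<Phi> Q\<^sub>0. \<forall>\<epsilon>>0::real. \<exists>\<delta>>0::real. \<forall>g \<in> wiener_amalgam \<Phi> Q\<^sub>0.
        wiener_amalgam_norm \<Phi> Q\<^sub>0 (\<lambda>x. g x - f x) < ennreal \<delta> \<longrightarrow>
        orlicz_norm \<Phi> (lebesgue_on Q)
          (\<lambda>z. zak_transform \<Phi> Q g z - zak_transform \<Phi> Q f z) < ennreal \<epsilon>) \<and>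
     \<comment> \<open>injectivity\<close>
     (\<forall>f \<in> wiener_amalgam \<Phi> Q\<^sub>0. \<forall>g \<in> wiener_amalgam \<Phi> Q\<^sub>0.
        (AE z in lebesgue_on Q. zak_transform \<Phi> Q f z = zak_transform \<Phi> Q g z) \<longrightarrow>
        (AE x in lebesgue. f x = g x))"
proof -
  obtain c where "box c (c + One) \<subseteq> Q" "Q \<subseteq> cbox c (c + One)"
    using assms(4) by (auto simp: unit_cube_def)
  then obtain a b where Q: "box (a, b) ((a, b) + One) \<subseteq> Q" "Q \<subseteq> cbox (a, b) ((a, b) + One)"
    by (cases c) auto
  note Y = assms(1)
  interpret finite_measure "lebesgue_on Q"
    by (rule finite_measure_lebesgue_on[OF between_boxes_lmeasurable(1)[OF Q]])
  let ?M = "lebesgue_on Q" and ?W = "wiener_amalgam \<Phi> Q\<^sub>0" and ?N = "wiener_amalgam_norm \<Phi> Q\<^sub>0"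
    and ?Z = "zak_transform \<Phi> Q"
  obtain C :: real where C: "0 < C"
    "\<And>f. f \<in> ?W \<Longrightarrow> has_orlicz_sum \<Phi> ?M (zak_term f) int_lattice (?Z f)"
    "\<And>f. f \<in> ?W \<Longrightarrow> orlicz_norm \<Phi> ?M (?Z f) \<le> ennreal C * ?N f"
    by (rule zak_series_summable[OF Y assms(2,3) Q]) (rule that)
  have uniq: "AE z in ?M. F z = ?Z f z"
    if "f \<in> ?W" "has_orlicz_sum \<Phi> ?M (zak_term f) int_lattice F" for f F
    by (rule has_orlicz_sum_unique[OF Y that(2) C(2)[OF that(1)]])
  have orl: "?Z f \<in> orlicz_space \<Phi> ?M" if "f \<in> ?W" for f
    using C(2)[OF that] by (simp add: has_orlicz_sum_def)
  have lin: "(\<lambda>x. p * f x + q * g x) \<in> ?W"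
    "AE z in ?M. ?Z (\<lambda>x. p * f x + q * g x) z = p * ?Z f z + q * ?Z g z"
    if fg: "f \<in> ?W" "g \<in> ?W" for f g p q
  proof -
    show W: "(\<lambda>x. p * f x + q * g x) \<in> ?W"
      by (rule wiener_amalgam_lincomb[OF Y assms(2) fg])
    have "zak_term (\<lambda>x. p * f x + q * g x) = (\<lambda>k z. p * zak_term f k z + q * zak_term g k z)"
      by (simp add: fun_eq_iff zak_term_eq algebra_simps)
    with has_orlicz_sum_lincomb[OF Y C(2)[OF fg(1)] C(2)[OF fg(2)], of p q]
    have "has_orlicz_sum \<Phi> ?M (zak_term (\<lambda>x. p * f x + q * g x)) int_lattice (\<lambda>z. p * ?Z f z + q * ?Z g z)"
      by simp
    from uniq[OF W this] show "AE z in ?M. ?Z (\<lambda>x. p * f x + q * g x) z = p * ?Z f z + q * ?Z g z"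
      by eventually_elim simp
  qed
  have diff: "(\<lambda>x. f x - g x) \<in> ?W" "AE z in ?M. ?Z (\<lambda>x. f x - g x) z = ?Z f z - ?Z g z"
    if "f \<in> ?W" "g \<in> ?W" for f g
    using lin[OF that, of 1 "-1"] by simp_all
  have resp: "AE z in ?M. ?Z f z = ?Z g z"
    if fg: "f \<in> ?W" "g \<in> ?W" and eq: "AE x in lebesgue. f x = g x" for f g
  proof -
    \<comment> \<open>The amalgam norm ignores null sets, so boundedness applied to the difference
      gives a transform of norm 0.\<close>
    have "?N (\<lambda>x. f x - g x) = 0"
      by (rule wiener_amalgam_norm_zero_AE) (use eq in \<open>simp\<close>)
    then have "orlicz_norm \<Phi> ?M (?Z (\<lambda>x. f x - g x)) = 0"
      using C(3)[OF diff(1)[OF fg]] by simp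
    then have "AE z in ?M. ?Z (\<lambda>x. f x - g x) z = 0"
      using orlicz_spaceD[OF orl[OF diff(1)[OF fg]]] by (intro orlicz_norm_zeroD[OF Y])
    with diff(2)[OF fg] show ?thesis by eventually_elim simp
  qed
  have cont: "orlicz_norm \<Phi> ?M (\<lambda>z. ?Z g z - ?Z f z) < ennreal \<epsilon>"
    if fg: "f \<in> ?W" "g \<in> ?W" and \<epsilon>: "\<epsilon> > 0" and N: "?N (\<lambda>x. g x - f x) < ennreal (\<epsilon> / C)" for f g \<epsilon>
  proof -
    obtain n where n: "n \<ge> 0" "?N (\<lambda>x. g x - f x) = ennreal n"
      using N by (cases "?N (\<lambda>x. g x - f x)" rule: ennreal_cases) auto
    have "orlicz_norm \<Phi> ?M (\<lambda>z. ?Z g z - ?Z f z) = orlicz_norm \<Phi> ?M (?Z (\<lambda>x. g x - f x))"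
      by (rule orlicz_norm_cong_AE) (use diff(2)[OF fg(2,1)] in \<open>auto elim: eventually_mono\<close>)
    also have "\<dots> \<le> ennreal (C * n)"
      using C(3)[OF diff(1)[OF fg(2,1)]] n C(1) by (simp add: ennreal_mult)
    also have "\<dots> < ennreal \<epsilon>"
      using N n C(1) \<epsilon> by (simp add: ennreal_less_iff field_simps)
    finally show ?thesis .
  qed
  have inj: "AE x in lebesgue. f x = g x"
    if fg: "f \<in> ?W" "g \<in> ?W" and eq: "AE z in ?M. ?Z f z = ?Z g z" for f g
  proof -
    \<comment> \<open>Linearity reduces injectivity to a trivial kernel.\<close>
    have "AE z in ?M. ?Z (\<lambda>x. f x - g x) z = 0"
      using diff(2)[OF fg] eq by eventually_elim simp
    moreover have "(\<lambda>x. f x - g x) \<in> borel_measurable lebesgue"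
      using diff(1)[OF fg] by (simp add: wiener_amalgam_def)
    ultimately have "AE x in lebesgue. f x - g x = 0"
      using zak_zero_imp_zero[OF Y _ Q C(2)[OF diff(1)[OF fg]]] by blast
    then show ?thesis by simp
  qed
  show ?thesis
  proof (intro conjI ballI allI impI)
    fix f assume f: "f \<in> ?W"
    show "has_orlicz_sum \<Phi> ?M (zak_term f) int_lattice (?Z f)" by (rule C(2)[OF f])
    show "AE z in ?M. F z = ?Z f z" if "has_orlicz_sum \<Phi> ?M (zak_term f) int_lattice F" for F
      by (rule uniq[OF f that])
    show "?Z f \<in> orlicz_space \<Phi> ?M" by (rule orl[OF f])
    show "\<exists>\<delta>>0. \<forall>g\<in>?W. ?N (\<lambda>x. g x - f x) < ennreal \<delta> \<longrightarrow>
        orlicz_norm \<Phi> ?M (\<lambda>z. ?Z g z - ?Z f z) < ennreal \<epsilon>" if "0 < \<epsilon>" for \<epsilon>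
      using cont[OF f] C(1) that by (intro exI[of _ "\<epsilon> / C"]) auto
    fix g assume g: "g \<in> ?W"
    show "AE z in ?M. ?Z f z = ?Z g z" if "AE x in lebesgue. f x = g x"
      by (rule resp[OF f g that])
    show "(\<lambda>x. p * f x + q * g x) \<in> ?W" for p q
      by (rule lin(1)[OF f g])
    show "AE z in ?M. ?Z (\<lambda>x. p * f x + q * g x) z = p * ?Z f z + q * ?Z g z" for p q
      by (rule lin(2)[OF f g])
    show "AE x in lebesgue. f x = g x" if "AE z in ?M. ?Z f z = ?Z g z"
      by (rule inj[OF f g that])
  qed
qed

end
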